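(* Let $(X,x_0)$ be a pointed space which is first countable at $x_0$ and locally infinite-connected at $x_0$. Then $$\mathcal{H}_\infty(X,x_0)\cong\prod^w_{n\in\mathbb{N}}\prod^w_{k\in\mathbb{N}}\pi_n(X,x_0).$$
   Context: $(X,x_0)$ is locally infinite-connected if for each open set $U$ containing $x_0$ there is a neighborhood $V$ of $x_0$ such that the inclusion $V\hookrightarrow U$ induces the trivial homomorphism $\pi_n(V,x_0)\to\pi_n(U,x_0)$ for all $n\in\mathbb{N}$. For $n\geq1$, $\mathbb{H}^n=\{(r_0,\dots,r_n)\in\mathbb{R}^{n+1} : (r_0-1/k)^2+\sum_{i=1}^n r_i^2=(1/k)^2 \text{ for some } k\in\mathbb{N}\}$ is the $n$-dimensional Hawaiian earring with base point $\theta$ (the origin); $S^n_k$ is its sphere of radius $1/k$. $\mathbb{H}^\infty$ is the weak join of $\{(\mathbb{H}^n,\theta)\}_{n\in\mathbb{N}}$: the disjoint union with all base points identified to $\theta$, where $U$ is open iff $U\cap\mathbb{H}^n$ is open in $\mathbb{H}^n$ for all $n$ and, if $\theta\in U$, then $\mathbb{H}^n\subseteq U$ for all but finitely many $n$. $\mathcal{H}_\infty(X,x_0)$ is the set of pointed homotopy classes (rel $\{\theta\}$) of continuous maps $(\mathbb{H}^\infty,\theta)\to(X,x_0)$, with group operation $[f][g]=[f\ast g]$ where on each sphere $S^n_k\subseteq\mathbb{H}^n$, $(f\ast g)|_{S^n_k}$ is the usual $\pi_n$-concatenation of $f|_{S^n_k}$ and $g|_{S^n_k}$. $\prod^w$ denotes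 the weak direct product (families with all but finitely many entries trivial). *)

theory Defs
  imports "HOL-Analysis.Analysis" "HOL-Algebra.Product_Groups"
begin

definition first_countable_at :: "'a topology \<Rightarrow> 'a \<Rightarrow> bool" where
  "first_countable_at X x0 \<longleftrightarrow>
     (\<exists>\<B>. countable \<B> \<and> (\<forall>V\<in>\<B>. openin X V \<and> x0 \<in> V) \<and>
          (\<forall>U. openin X U \<and> x0 \<in> U \<longrightarrow> (\<exists>V\<in>\<B>. V \<subseteq> U)))"

definition hcube_top :: "nat \<Rightarrow> (nat \<Rightarrow> real) topology" where
  "hcube_top n = product_topology (\<lambda>_. top_of_set {0..1}) {..<n}"

definition hcube_boundary :: "nat \<Rightarrow> (nat \<Rightarrow> real) set" where
  "hcube_boundary n = {t \<in> topspace (hcube_top n). \<exists>i<n. t i = 0 \<or> t i = 1}"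

definition hsph_maps :: "nat \<Rightarrow> 'a topology \<Rightarrow> 'a \<Rightarrow> ((nat \<Rightarrow> real) \<Rightarrow> 'a) set" where
  "hsph_maps n X x0 = {f. continuous_map (hcube_top n) X f \<and> (\<forall>t\<in>hcube_boundary n. f t = x0)}"

definition hrel_homotopic :: "nat \<Rightarrow> 'a topology \<Rightarrow> 'a \<Rightarrow> ((nat \<Rightarrow> real) \<Rightarrow> 'a) \<Rightarrow> ((nat \<Rightarrow> real) \<Rightarrow> 'a) \<Rightarrow> bool" where
  "hrel_homotopic n X x0 f g \<longleftrightarrow>
     homotopic_with (\<lambda>h. \<forall>t\<in>hcube_boundary n. h t = x0) (hcube_top n) X f g"

definition hclass :: "nat \<Rightarrow> 'a topology \<Rightarrow> 'a \<Rightarrow> ((nat \<Rightarrow> real) \<Rightarrow> 'a) \<Rightarrow> ((nat \<Rightarrow> real) \<Rightarrow> 'a) set" where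
  "hclass n X x0 f = {g \<in> hsph_maps n X x0. hrel_homotopic n X x0 f g}"

definition cube_concat :: "((nat \<Rightarrow> real) \<Rightarrow> 'a) \<Rightarrow> ((nat \<Rightarrow> real) \<Rightarrow> 'a) \<Rightarrow> (nat \<Rightarrow> real) \<Rightarrow> 'a" where
  "cube_concat f g t = (if t 0 \<le> 1/2 then f (t(0 := 2 * t 0)) else g (t(0 := 2 * t 0 - 1)))"

definition homotopy_group :: "nat \<Rightarrow> 'a topology \<Rightarrow> 'a \<Rightarrow> ((nat \<Rightarrow> real) \<Rightarrow> 'a) set monoid" where
  "homotopy_group n X x0 =
     \<lparr>carrier = hclass n X x0 ` hsph_maps n X x0,
      monoid.mult = (\<lambda>A B. hclass n X x0 (cube_concat (SOME f. f \<in> A) (SOME g. g \<in> B))),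
      one = hclass n X x0 (\<lambda>_. x0)\<rparr>"

text \<open>H^n as a subset of R^{n+1}, points (r_0,...,r_n) represented by functions vanishing beyond n.\<close>
definition hsphere :: "nat \<Rightarrow> nat \<Rightarrow> (nat \<Rightarrow> real) set" where
  "hsphere n k = {r. (\<forall>i>n. r i = 0) \<and>
      (r 0 - 1 / real k)\<^sup>2 + (\<Sum>i=1..n. (r i)\<^sup>2) = (1 / real k)\<^sup>2}"

definition hawaiian :: "nat \<Rightarrow> (nat \<Rightarrow> real) set" where
  "hawaiian n = (\<Union>k\<in>{1..}. hsphere n k)"

text \<open>Weak join: points are tagged (n, r); all base points identified with theta.\<close>
definition hjoin_base :: "nat \<times> (nat \<Rightarrow> real)" where
  "hjoin_base = (0, (\<lambda>_. 0))"

definition hjoin_incl :: "nat \<Rightarrow> (nat \<Rightarrow> real) \<Rightarrow> nat \<times> (nat \<Rightarrow> real)" where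
  "hjoin_incl n r = (if r = (\<lambda>_. 0) then hjoin_base else (n, r))"

definition hjoin_carrier :: "(nat \<times> (nat \<Rightarrow> real)) set" where
  "hjoin_carrier = insert hjoin_base (\<Union>n\<in>{1..}. hjoin_incl n ` hawaiian n)"

definition hawaiian_inf :: "(nat \<times> (nat \<Rightarrow> real)) topology" where
  "hawaiian_inf = topology (\<lambda>U. U \<subseteq> hjoin_carrier \<and>
      (\<forall>n\<in>{1..}. openin (top_of_set (hawaiian n)) {r \<in> hawaiian n. hjoin_incl n r \<in> U}) \<and>
      (hjoin_base \<in> U \<longrightarrow> finite {n\<in>{1..}. \<not> hjoin_incl n ` hawaiian n \<subseteq> U}))"

text \<open>Standard quotient map I^n \<rightarrow> S^n_k collapsing the boundary of the cube to theta.\<close>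
definition cube_to_sphere :: "nat \<Rightarrow> nat \<Rightarrow> (nat \<Rightarrow> real) \<Rightarrow> (nat \<Rightarrow> real)" where
  "cube_to_sphere n k t =
     (let v = (\<lambda>i. 2 * t i - 1);
          s = Max ((\<lambda>i. \<bar>v i\<bar>) ` {..<n});
          nv = sqrt (\<Sum>i<n. (v i)\<^sup>2)
      in (\<lambda>j. if j = 0 then (1 + cos (pi * s)) / real k
              else if j \<le> n then sin (pi * s) * v (j - 1) / (real k * nv)
              else 0))"

definition hinf_maps :: "'a topology \<Rightarrow> 'a \<Rightarrow> ((nat \<times> (nat \<Rightarrow> real)) \<Rightarrow> 'a) set" where
  "hinf_maps X x0 = {f. continuous_map hawaiian_inf X f \<and> f hjoin_base = x0}"

definition hinf_class :: "'a topology \<Rightarrow> 'a \<Rightarrow> ((nat \<times> (nat \<Rightarrow> real)) \<Rightarrow> 'a) \<Rightarrow> ((nat \<times> (nat \<Rightarrow> real)) \<Rightarrow> 'a) set" where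
  "hinf_class X x0 f =
     {g \<in> hinf_maps X x0. homotopic_with (\<lambda>h. h hjoin_base = x0) hawaiian_inf X f g}"

definition hinf_concat :: "'a topology \<Rightarrow> 'a \<Rightarrow> ((nat \<times> (nat \<Rightarrow> real)) \<Rightarrow> 'a) \<Rightarrow> ((nat \<times> (nat \<Rightarrow> real)) \<Rightarrow> 'a) \<Rightarrow> ((nat \<times> (nat \<Rightarrow> real)) \<Rightarrow> 'a)" where
  "hinf_concat X x0 f g = (SOME h. h \<in> hinf_maps X x0 \<and>
      (\<forall>n\<in>{1..}. \<forall>k\<in>{1..}. \<forall>t\<in>topspace (hcube_top n).
         h (hjoin_incl n (cube_to_sphere n k t)) =
         cube_concat (f \<circ> hjoin_incl n \<circ> cube_to_sphere n k) (g \<circ> hjoin_incl n \<circ> cube_to_sphere n k) t))"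

definition Hinf_group :: "'a topology \<Rightarrow> 'a \<Rightarrow> ((nat \<times> (nat \<Rightarrow> real)) \<Rightarrow> 'a) set monoid" where
  "Hinf_group X x0 =
     \<lparr>carrier = hinf_class X x0 ` hinf_maps X x0,
      monoid.mult = (\<lambda>A B. hinf_class X x0 (hinf_concat X x0 (SOME f. f \<in> A) (SOME g. g \<in> B))),
      one = hinf_class X x0 (\<lambda>_. x0)\<rparr>"

definition locally_infinite_connected :: "'a topology \<Rightarrow> 'a \<Rightarrow> bool" where
  "locally_infinite_connected X x0 \<longleftrightarrow>
     (\<forall>U. openin X U \<and> x0 \<in> U \<longrightarrow>
        (\<exists>V. (\<exists>W. openin X W \<and> x0 \<in> W \<and> W \<subseteq> V) \<and> V \<subseteq> U \<and>
             (\<forall>n\<in>{1..}. \<forall>f \<in> hsph_maps n (subtopology X V) x0.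
                 hrel_homotopic n (subtopology X U) x0 f (\<lambda>_. x0))))"

end

theory Submission
  imports Defs
begin

text \<open>
  Restricting a map on the weak join to the spheres gives one class in \<open>\<pi>\<^sub>n(X, x0)\<close> for each
  \<open>(n, k)\<close>. By continuity at the base point almost all spheres are mapped into a given neighbourhood
  of \<open>x0\<close>, so by local infinite-connectedness almost all of these classes are trivial. Conversely, a
  family of maps (or homotopies) on the cubes descends to the weak join as soon as it is null, that
  is, almost all of its members lie in any given neighbourhood of \<open>x0\<close>. This gives surjectivity at
  once, since almost all members can be taken constant. For injectivity, a countable neighbourhood
  base at \<open>x0\<close> allows the homotopies on the single spheres to be chosen in smaller and smaller
  neighbourhoods, so that they form a null family.
\<close>

subsection \<open>Homotopy groups of cubes\<close>

text \<open>The topology of the weak join is coarser than that of a wedge of cells: a neighbourhood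
  of the base point contains almost all spheres entirely, so continuity on every single sphere does
  not give continuity of the glued map. Smallness near \<open>x0\<close> is therefore carried along
  as finiteness of a set of pairs \<open>(n, k)\<close>. For injectivity the obstacle is that the
  given homotopies between restrictions may be large. They are kept on finitely many spheres only;
  elsewhere they are replaced by a contraction of one restriction followed by a reversed contraction
  of the other, both inside a prescribed neighbourhood. It is essential that one neighbourhood works
  for all dimensions at once, since \<open>n\<close> is unbounded along the join. On the algebraic
  side products are taken of representatives chosen by \<open>SOME\<close>, and
  \<open>sum_group\<close> is a generated subgroup of the full product. The group axioms for
  \<open>homotopy_group\<close> are what turns its carrier into the set of families of finite
  support.\<close>

lemma topspace_hcube_top [simp]: "topspace (hcube_top n) = PiE {..<n} (\<lambda>_. {0..1})"
  by (simp add: hcube_top_def)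

text \<open>This opens the cubes to \<open>continuous_on\<close> reasoning. All coordinates beyond
  \<open>n\<close> have the fixed value \<open>undefined\<close>, so passing to the product over all
  indices only adds constant coordinates.\<close>

lemma hcube_top_eq: "hcube_top n = top_of_set (PiE {..<n} (\<lambda>_. {0..1}))"
proof -
  let ?C = "PiE {..<n} (\<lambda>_. {0..1::real})"
  have "continuous_map (hcube_top n) (top_of_set ?C) id"
  proof -
    have "continuous_map (hcube_top n) euclidean (\<lambda>x. x i)" for i
    proof (cases "i < n")
      case True
      then show ?thesis
        unfolding hcube_top_def
        using continuous_map_product_projection[of i "{..<n}" "\<lambda>_. top_of_set {0..1::real}"]
        by (simp add: continuous_map_in_subtopology)
    next
      case False
      have "continuous_map (hcube_top n) euclidean (\<lambda>x. undefined :: real)"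
        by simp
      then show ?thesis
        by (rule continuous_map_eq) (use False in \<open>auto simp: PiE_def extensional_def\<close>)
    qed
    then have "continuous_map (hcube_top n) (product_topology (\<lambda>_. euclidean) UNIV) id"
      by (simp add: continuous_map_componentwise_UNIV)
    then show ?thesis
      by (simp add: euclidean_product_topology continuous_map_in_subtopology)
  qed
  moreover have "continuous_map (top_of_set ?C) (hcube_top n) id"
    unfolding hcube_top_def continuous_map_componentwise
    by (auto simp: continuous_map_in_subtopology PiE_def
        intro!: continuous_on_subset[OF continuous_on_product_coordinates])
  ultimately have "homeomorphic_maps (hcube_top n) (top_of_set ?C) id id"
    by (simp add: homeomorphic_maps_def)
  then show ?thesis
    by (simp add: homeomorphic_maps_id)
qed

lemma compact_hcube: "compact_space (hcube_top n)"
  unfolding hcube_top_def by (simp add: compact_space_product_topology compact_space_subtopology)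

lemma hcube_upd:
  "\<lbrakk>t \<in> PiE {..<n} (\<lambda>_. {0..1::real}); i < n; 0 \<le> a; a \<le> 1\<rbrakk> \<Longrightarrow> t(i := a) \<in> PiE {..<n} (\<lambda>_. {0..1})"
  by (auto simp: PiE_iff extensional_def)

lemma hcube_coord: "\<lbrakk>t \<in> PiE {..<n} (\<lambda>_. {0..1::real}); i < n\<rbrakk> \<Longrightarrow> 0 \<le> t i \<and> t i \<le> 1"
  by (auto simp: PiE_iff)

lemma hcube_boundary_iff:
  "t \<in> hcube_boundary n \<longleftrightarrow> t \<in> PiE {..<n} (\<lambda>_. {0..1}) \<and> (\<exists>i<n. t i = 0 \<or> t i = 1)"
  by (simp add: hcube_boundary_def)

lemma hcube_upd_boundary:
  assumes "t \<in> PiE {..<n} (\<lambda>_. {0..1})" "n \<ge> 1" "a = 0 \<or> a = 1"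
  shows "t(0 := a) \<in> hcube_boundary n"
proof -
  have "t(0 := a) \<in> PiE {..<n} (\<lambda>_. {0..1})"
    using assms(2,3) by (intro hcube_upd[OF assms(1)]) auto
  then show ?thesis
    using assms(2,3) unfolding hcube_boundary_iff by (metis One_nat_def Suc_le_eq fun_upd_same)
qed

lemma continuous_on_upd_fun:
  fixes f :: "'c::topological_space \<Rightarrow> nat \<Rightarrow> real"
  assumes "continuous_on S f" "continuous_on S g"
  shows "continuous_on S (\<lambda>x. (f x)(i := g x))"
proof (rule continuous_on_coordinatewise_then_product)
  fix j
  show "continuous_on S (\<lambda>x. ((f x)(i := g x)) j)"
    using assms by (cases "j = i") (auto intro: continuous_on_product_then_coordinatewise)
qed

lemma continuous_on_snd_coord [continuous_intros]:
  "continuous_on S (\<lambda>z :: 'c::topological_space \<times> (nat \<Rightarrow> real). snd z i)"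
  by (rule continuous_on_product_then_coordinatewise) (rule continuous_on_snd[OF continuous_on_id])

abbreviation unit_cyl :: "nat \<Rightarrow> (real \<times> (nat \<Rightarrow> real)) topology" where
  "unit_cyl n \<equiv> prod_topology (top_of_set {0..1}) (hcube_top n)"

lemma unit_cyl_eq: "unit_cyl n = top_of_set ({0..1} \<times> PiE {..<n} (\<lambda>_. {0..1}))"
  by (simp add: hcube_top_eq)

text \<open>At the seam \<open>t 0 = 1/2\<close> the two branches are evaluated on the faces with
  first coordinate 1 and 0, where both take the value \<open>x0\<close>. The version for cylinders
  covers homotopies, and plain maps by freezing the parameter.\<close>

lemma continuous_map_cube_concat:
  assumes "n \<ge> 1"
    and F: "continuous_map (unit_cyl n) X F" "\<And>s t. \<lbrakk>s \<in> {0..1}; t \<in> hcube_boundary n\<rbrakk> \<Longrightarrow> F (s, t) = x0"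
    and G: "continuous_map (unit_cyl n) X G" "\<And>s t. \<lbrakk>s \<in> {0..1}; t \<in> hcube_boundary n\<rbrakk> \<Longrightarrow> G (s, t) = x0"
  shows "continuous_map (unit_cyl n) X (\<lambda>(s, t). cube_concat (\<lambda>t. F (s, t)) (\<lambda>t. G (s, t)) t)"
proof -
  let ?C = "PiE {..<n} (\<lambda>_. {0..1::real})"
  define D where "D = {0..1::real} \<times> ?C"
  have "continuous_map (top_of_set D) X
     (\<lambda>z. if snd z 0 \<le> 1/2 then F (fst z, (snd z)(0 := 2 * snd z 0)) else G (fst z, (snd z)(0 := 2 * snd z 0 - 1)))"
  proof (rule continuous_map_cases_le)
    show "continuous_map (top_of_set D) euclidean (\<lambda>z. snd z 0)"
      by (auto intro!: continuous_intros)
    have cont: "continuous_on S (\<lambda>z :: real \<times> (nat \<Rightarrow> real). (fst z, (snd z)(0 := 2 * snd z 0 - c)))" for S c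
      by (intro continuous_on_Pair continuous_on_upd_fun continuous_on_diff continuous_on_mult continuous_on_snd_coord
          continuous_on_fst continuous_on_snd continuous_on_id continuous_on_const)
    have 1: "continuous_map (subtopology (top_of_set D) {x \<in> topspace (top_of_set D). snd x 0 \<le> 1/2}) (top_of_set D)
       (\<lambda>z. (fst z, (snd z)(0 := 2 * snd z 0)))"
      using \<open>n \<ge> 1\<close> cont[of _ 0] hcube_coord[of _ n 0]
      by (auto simp: subtopology_subtopology D_def continuous_map_in_subtopology intro!: hcube_upd)
    have 2: "continuous_map (subtopology (top_of_set D) {x \<in> topspace (top_of_set D). 1/2 \<le> snd x 0}) (top_of_set D)
       (\<lambda>z. (fst z, (snd z)(0 := 2 * snd z 0 - 1)))"
      using \<open>n \<ge> 1\<close> cont[of _ 1] hcube_coord[of _ n 0]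
      by (auto simp: subtopology_subtopology D_def continuous_map_in_subtopology intro!: hcube_upd)
    show "continuous_map (subtopology (top_of_set D) {x \<in> topspace (top_of_set D). snd x 0 \<le> 1/2}) X
       (\<lambda>z. F (fst z, (snd z)(0 := 2 * snd z 0)))"
      using continuous_map_compose[OF 1, of X F] F(1) unfolding unit_cyl_eq D_def[symmetric] by (simp add: o_def)
    show "continuous_map (subtopology (top_of_set D) {x \<in> topspace (top_of_set D). 1/2 \<le> snd x 0}) X
       (\<lambda>z. G (fst z, (snd z)(0 := 2 * snd z 0 - 1)))"
      using continuous_map_compose[OF 2, of X G] G(1) unfolding unit_cyl_eq D_def[symmetric] by (simp add: o_def)
    fix z assume z: "z \<in> topspace (top_of_set D)" "snd z 0 = 1/2"
    then have "fst z \<in> {0..1}" "snd z \<in> ?C"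
      by (simp_all add: D_def mem_Times_iff)
    then show "F (fst z, (snd z)(0 := 2 * snd z 0)) = G (fst z, (snd z)(0 := 2 * snd z 0 - 1))"
      using z(2) F(2) G(2) hcube_upd_boundary[of "snd z" n] \<open>n \<ge> 1\<close> by simp
  qed auto
  then show ?thesis
    unfolding unit_cyl_eq D_def[symmetric] by (simp add: cube_concat_def case_prod_unfold)
qed

lemma cube_concat_boundary:
  assumes "n \<ge> 1" "t \<in> hcube_boundary n"
    and f: "\<And>t. t \<in> hcube_boundary n \<Longrightarrow> f t = x0" and g: "\<And>t. t \<in> hcube_boundary n \<Longrightarrow> g t = x0"
  shows "cube_concat f g t = x0"
proof -
  obtain i where i: "i < n" "t i = 0 \<or> t i = 1" and t: "t \<in> PiE {..<n} (\<lambda>_. {0..1})"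
    using assms by (auto simp: hcube_boundary_iff)
  have 0: "0 \<le> t 0" "t 0 \<le> 1"
    using hcube_coord[OF t, of 0] \<open>n \<ge> 1\<close> by auto
  show ?thesis
  proof (cases "t 0 \<le> 1/2")
    case True
    then have "t(0 := 2 * t 0) \<in> hcube_boundary n"
      using i t \<open>n \<ge> 1\<close> 0 by (cases "i = 0") (auto simp: hcube_boundary_iff hcube_upd intro!: exI[of _ i])
    with True f show ?thesis by (simp add: cube_concat_def)
  next
    case False
    then have "t(0 := 2 * t 0 - 1) \<in> hcube_boundary n"
      using i t \<open>n \<ge> 1\<close> 0 by (cases "i = 0") (auto simp: hcube_boundary_iff hcube_upd intro!: exI[of _ i])
    with False g show ?thesis by (simp add: cube_concat_def)
  qed
qed

text \<open>Hence a concatenation stays in any neighbourhood that contains both factors, which keeps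
  concatenated families null.\<close>

lemma cube_concat_in_range:
  assumes "n \<ge> 1" "t \<in> topspace (hcube_top n)"
  shows "cube_concat f g t \<in> f ` topspace (hcube_top n) \<union> g ` topspace (hcube_top n)"
  using assms hcube_coord[of t n 0] by (auto simp: cube_concat_def hcube_upd)

lemma hsph_maps_concat:
  assumes "n \<ge> 1" "f \<in> hsph_maps n X x0" "g \<in> hsph_maps n X x0"
  shows "cube_concat f g \<in> hsph_maps n X x0"
proof -
  have *: "continuous_map (unit_cyl n) X (\<lambda>z. h (snd z))" if "h \<in> hsph_maps n X x0" for h
    using that continuous_map_compose[OF continuous_map_snd] by (auto simp: hsph_maps_def o_def)
  have b: "h t = x0" if "h \<in> hsph_maps n X x0" "t \<in> hcube_boundary n" for h t
    using that by (simp add: hsph_maps_def)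
  have 1: "continuous_map (unit_cyl n) X (\<lambda>(s, t). cube_concat (\<lambda>t. f (snd (s, t))) (\<lambda>t. g (snd (s, t))) t)"
    by (rule continuous_map_cube_concat[where ?x0.0=x0]) (use assms * b in auto)
  have "continuous_map (hcube_top n) (unit_cyl n) (\<lambda>t. (0, t))"
    by (auto simp: continuous_map_pairwise o_def)
  from continuous_map_compose[OF this 1] show ?thesis
    using cube_concat_boundary[OF \<open>n \<ge> 1\<close>, where f=f and g=g] b assms by (auto simp: hsph_maps_def o_def)
qed

lemma hrel_homotopic_concat:
  assumes "n \<ge> 1" "hrel_homotopic n X x0 f f'" "hrel_homotopic n X x0 g g'"
  shows "hrel_homotopic n X x0 (cube_concat f g) (cube_concat f' g')"
proof -
  obtain F where F: "continuous_map (unit_cyl n) X F" "\<And>x. F (0, x) = f x" "\<And>x. F (1, x) = f' x"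
    "\<And>s t. \<lbrakk>s \<in> {0..1}; t \<in> hcube_boundary n\<rbrakk> \<Longrightarrow> F (s, t) = x0"
    using assms(2) unfolding hrel_homotopic_def homotopic_with_def by blast
  obtain G where G: "continuous_map (unit_cyl n) X G" "\<And>x. G (0, x) = g x" "\<And>x. G (1, x) = g' x"
    "\<And>s t. \<lbrakk>s \<in> {0..1}; t \<in> hcube_boundary n\<rbrakk> \<Longrightarrow> G (s, t) = x0"
    using assms(3) unfolding hrel_homotopic_def homotopic_with_def by blast
  show ?thesis
    unfolding hrel_homotopic_def homotopic_with_def
  proof (intro exI conjI allI ballI)
    show "continuous_map (unit_cyl n) X (\<lambda>(s, t). cube_concat (\<lambda>t. F (s, t)) (\<lambda>t. G (s, t)) t)"
      by (rule continuous_map_cube_concat[OF \<open>n \<ge> 1\<close> F(1,4) G(1,4)])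
    fix s :: real and t assume "s \<in> {0..1}" "t \<in> hcube_boundary n"
    then show "(\<lambda>(s, t). cube_concat (\<lambda>t. F (s, t)) (\<lambda>t. G (s, t)) t) (s, t) = x0"
      using cube_concat_boundary[OF \<open>n \<ge> 1\<close>, where f="\<lambda>t. F (s, t)" and g="\<lambda>t. G (s, t)"] F(4) G(4) by simp
  qed (use F G in auto)
qed

lemma hrel_homotopic_imp_hsph:
  "hrel_homotopic n X x0 f g \<Longrightarrow> f \<in> hsph_maps n X x0 \<and> g \<in> hsph_maps n X x0"
  unfolding hrel_homotopic_def hsph_maps_def
  by (metis (mono_tags, lifting) homotopic_with_imp_continuous_maps homotopic_with_imp_property mem_Collect_eq)

lemma hrel_homotopic_sym: "hrel_homotopic n X x0 f g \<Longrightarrow> hrel_homotopic n X x0 g f"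
  unfolding hrel_homotopic_def by (rule homotopic_with_symD)

lemma hrel_homotopic_trans:
  "\<lbrakk>hrel_homotopic n X x0 f g; hrel_homotopic n X x0 g h\<rbrakk> \<Longrightarrow> hrel_homotopic n X x0 f h"
  unfolding hrel_homotopic_def by (rule homotopic_with_trans)

text \<open>Maps are total functions and \<open>homotopic_with\<close> prescribes its end maps
  everywhere, so maps that agree only on the cube have to be identified up to homotopy.\<close>

lemma hrel_homotopic_equal:
  "\<lbrakk>f \<in> hsph_maps n X x0; \<And>t. t \<in> topspace (hcube_top n) \<Longrightarrow> f t = g t\<rbrakk> \<Longrightarrow> hrel_homotopic n X x0 f g"
  unfolding hrel_homotopic_def hsph_maps_def
  by (rule homotopic_with_equal) (auto simp: hcube_boundary_def)

lemma hrel_homotopic_refl: "f \<in> hsph_maps n X x0 \<Longrightarrow> hrel_homotopic n X x0 f f"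
  by (rule hrel_homotopic_equal) auto

lemma hclass_eq_iff:
  assumes "f \<in> hsph_maps n X x0" "g \<in> hsph_maps n X x0"
  shows "hclass n X x0 f = hclass n X x0 g \<longleftrightarrow> hrel_homotopic n X x0 f g"
  using assms unfolding hclass_def
  by (auto intro: hrel_homotopic_refl hrel_homotopic_sym hrel_homotopic_trans)

lemma hclass_eqI: "hrel_homotopic n X x0 f g \<Longrightarrow> hclass n X x0 f = hclass n X x0 g"
  by (meson hclass_eq_iff hrel_homotopic_imp_hsph)

lemma some_in_hclass:
  assumes "f \<in> hsph_maps n X x0"
  shows "hrel_homotopic n X x0 f (SOME g. g \<in> hclass n X x0 f)"
proof -
  have "f \<in> hclass n X x0 f"
    using assms by (simp add: hclass_def hrel_homotopic_refl)
  then have "(SOME g. g \<in> hclass n X x0 f) \<in> hclass n X x0 f"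
    by (rule someI[of "\<lambda>g. g \<in> hclass n X x0 f"])
  then show ?thesis by (simp add: hclass_def)
qed

text \<open>The product in \<open>homotopy_group\<close> is taken of chosen representatives;
  homotopy invariance of concatenation makes the choice irrelevant.\<close>

lemma mult_hclass:
  assumes "n \<ge> 1" "f \<in> hsph_maps n X x0" "g \<in> hsph_maps n X x0"
  shows "hclass n X x0 f \<otimes>\<^bsub>homotopy_group n X x0\<^esub> hclass n X x0 g = hclass n X x0 (cube_concat f g)"
proof -
  have *: "hrel_homotopic n X x0 (cube_concat f g) (cube_concat (SOME h. h \<in> hclass n X x0 f) (SOME h. h \<in> hclass n X x0 g))"
    by (intro hrel_homotopic_concat some_in_hclass assms)
  then show ?thesis
    unfolding homotopy_group_def using hclass_eq_iff hrel_homotopic_imp_hsph[OF *] by fastforce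
qed

lemma hsph_const: "x0 \<in> topspace X \<Longrightarrow> (\<lambda>_. x0) \<in> hsph_maps n X x0"
  by (simp add: hsph_maps_def)

text \<open>The homotopy is the straight line between the two reparametrisations.\<close>

lemma hrel_homotopic_reparam:
  fixes \<phi> \<psi> :: "real \<Rightarrow> real"
  assumes "n \<ge> 1" and f: "f \<in> hsph_maps n X x0"
    and \<phi>: "continuous_on {0..1} \<phi>" "\<phi> \<in> {0..1} \<rightarrow> {0..1}"
    and \<psi>: "continuous_on {0..1} \<psi>" "\<psi> \<in> {0..1} \<rightarrow> {0..1}"
    and eq: "\<psi> 0 = \<phi> 0" "\<psi> 1 = \<phi> 1" and ends: "\<phi> 0 \<in> {0, 1}" "\<phi> 1 \<in> {0, 1}"
  shows "hrel_homotopic n X x0 (\<lambda>t. f (t(0 := \<phi> (t 0)))) (\<lambda>t. f (t(0 := \<psi> (t 0))))"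
proof -
  let ?C = "PiE {..<n} (\<lambda>_. {0..1::real})"
  let ?k = "\<lambda>z. (snd z)(0 := (1 - fst z) * \<phi> (snd z 0) + fst z * \<psi> (snd z 0))"
  have conv: "0 \<le> (1 - s) * \<phi> a + s * \<psi> a \<and> (1 - s) * \<phi> a + s * \<psi> a \<le> 1" if "s \<in> {0..1}" "a \<in> {0..1}" for s a
    using that \<phi>(2) \<psi>(2) by (auto intro!: convex_bound_le add_nonneg_nonneg mult_nonneg_nonneg)
  have inC: "?k (s, t) \<in> ?C" if "s \<in> {0..1}" "t \<in> ?C" for s t
    using that \<open>n \<ge> 1\<close> conv hcube_coord[of t n 0] by (auto intro!: hcube_upd)
  have c0: "continuous_on ({0..1} \<times> ?C) (\<lambda>z. snd z 0)"
    by (intro continuous_intros)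
  have im0: "(\<lambda>z. snd z 0) ` ({0..1::real} \<times> ?C) \<subseteq> {0..1}"
    using hcube_coord[of _ n 0] \<open>n \<ge> 1\<close> by auto
  have "continuous_on ({0..1} \<times> ?C) ?k"
    by (intro continuous_on_upd_fun continuous_on_add continuous_on_mult continuous_on_diff continuous_on_const
        continuous_on_fst continuous_on_snd continuous_on_id
        continuous_on_compose2[OF \<phi>(1) c0 im0] continuous_on_compose2[OF \<psi>(1) c0 im0])
  moreover have "?k z \<in> ?C" if "z \<in> {0..1} \<times> ?C" for z
    using inC[of "fst z" "snd z"] that by (simp add: mem_Times_iff)
  ultimately have k: "continuous_map (unit_cyl n) (hcube_top n) ?k"
    unfolding unit_cyl_eq hcube_top_eq by (simp add: continuous_map_in_subtopology Pi_iff)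
  have bd: "f (?k (s, t)) = x0" if s: "s \<in> {0..1}" and tb: "t \<in> hcube_boundary n" for s t
  proof -
    obtain i where i: "i < n" "t i = 0 \<or> t i = 1" and t: "t \<in> ?C"
      using tb by (auto simp: hcube_boundary_iff)
    \<comment> \<open>Both reparametrisations agree at 0 and 1, so the interpolation is constant in
      \<open>s\<close> there, with value 0 or 1. A first coordinate on the boundary thus stays on
      the boundary, and the other coordinates do not move.\<close>
    have "(1 - s) * \<phi> 0 + s * \<psi> 0 \<in> {0, 1}" "(1 - s) * \<phi> 1 + s * \<psi> 1 \<in> {0, 1}"
      using eq ends by (auto simp: algebra_simps)
    then have "?k (s, t) i = 0 \<or> ?k (s, t) i = 1"
      using i by (cases "i = 0") auto
    then have "?k (s, t) \<in> hcube_boundary n"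
      using inC[OF s t] i(1) unfolding hcube_boundary_iff by blast
    then show ?thesis
      using f by (simp add: hsph_maps_def)
  qed
  show ?thesis
    unfolding hrel_homotopic_def homotopic_with_def
  proof (intro exI conjI allI ballI)
    show "continuous_map (unit_cyl n) X (f \<circ> ?k)"
      by (rule continuous_map_compose[OF k]) (use f in \<open>simp add: hsph_maps_def\<close>)
  qed (use bd in auto)
qed

lemma hsph_maps_reparam:
  fixes \<phi> :: "real \<Rightarrow> real"
  assumes "n \<ge> 1" "f \<in> hsph_maps n X x0"
    "continuous_on {0..1} \<phi>" "\<phi> \<in> {0..1} \<rightarrow> {0..1}" "\<phi> 0 \<in> {0, 1}" "\<phi> 1 \<in> {0, 1}"
  shows "(\<lambda>t. f (t(0 := \<phi> (t 0)))) \<in> hsph_maps n X x0"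
  using hrel_homotopic_reparam[OF assms(1-4) assms(3-4) refl refl assms(5-6), THEN hrel_homotopic_imp_hsph] by (rule conjunct1)

text \<open>This is the comparison with the identity reparametrisation:
  \<open>f (t(0 := t 0))\<close> is just \<open>f t\<close>. The associative and unit laws are
  instances.\<close>

lemma hrel_homotopic_reparam_id:
  fixes \<phi> :: "real \<Rightarrow> real"
  assumes "n \<ge> 1" "f \<in> hsph_maps n X x0"
    "continuous_on {0..1} \<phi>" "\<phi> \<in> {0..1} \<rightarrow> {0..1}" "\<phi> 0 = 0" "\<phi> 1 = 1"
    and g: "\<And>t. t \<in> topspace (hcube_top n) \<Longrightarrow> f (t(0 := \<phi> (t 0))) = g t"
  shows "hrel_homotopic n X x0 g f"
proof -
  have "hrel_homotopic n X x0 (\<lambda>t. f (t(0 := \<phi> (t 0)))) (\<lambda>t. f (t(0 := t 0)))"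
    by (rule hrel_homotopic_reparam) (use assms in auto)
  moreover have "hrel_homotopic n X x0 (\<lambda>t. f (t(0 := \<phi> (t 0)))) g"
    by (intro hrel_homotopic_equal hsph_maps_reparam) (use assms in auto)
  ultimately show ?thesis
    by (metis (no_types, lifting) ext fun_upd_triv hrel_homotopic_sym hrel_homotopic_trans)
qed

lemma hrel_homotopic_assoc:
  assumes "n \<ge> 1" "f \<in> hsph_maps n X x0" "g \<in> hsph_maps n X x0" "h \<in> hsph_maps n X x0"
  shows "hrel_homotopic n X x0 (cube_concat (cube_concat f g) h) (cube_concat f (cube_concat g h))"
proof (rule hrel_homotopic_reparam_id)
  \<comment> \<open>The piecewise linear map taking the breakpoints 0, 1/4, 1/2, 1 to 0, 1/2, 3/4,
    1. Its slopes 2, 1, 1/2 decrease, so it is concave and equals the minimum of its three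
    lines.\<close>
  let ?\<phi> = "\<lambda>a::real. min (2 * a) (min (a + 1/4) ((1 + a) / 2))"
  show "continuous_on {0..1} ?\<phi>"
    by (intro continuous_intros) auto
  show "?\<phi> \<in> {0..1} \<rightarrow> {0..1}"
    by (auto simp: min_def)
  fix t assume "t \<in> topspace (hcube_top n)"
  consider "t 0 \<le> 1/4" | "1/4 < t 0" "t 0 \<le> 1/2" | "1/2 < t 0" by linarith
  then show "cube_concat f (cube_concat g h) (t(0 := ?\<phi> (t 0))) = cube_concat (cube_concat f g) h t"
  proof cases
    case 1
    then have "?\<phi> (t 0) = 2 * t 0" by (simp add: min_def)
    with 1 show ?thesis by (simp add: cube_concat_def )
  next
    case 2
    then have "?\<phi> (t 0) = t 0 + 1/4" by (simp add: min_def)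
    with 2 show ?thesis by (simp add: cube_concat_def algebra_simps)
  next
    case 3
    then have "?\<phi> (t 0) = (1 + t 0) / 2" by (simp add: min_def)
    with 3 show ?thesis by (simp add: cube_concat_def field_simps)
  qed
qed (use assms in \<open>auto intro!: hsph_maps_concat\<close>)

lemma hrel_homotopic_left_unit:
  assumes "n \<ge> 1" "f \<in> hsph_maps n X x0"
  shows "hrel_homotopic n X x0 (cube_concat (\<lambda>_. x0) f) f"
proof (rule hrel_homotopic_reparam_id)
  \<comment> \<open>The first half is squeezed onto the face \<open>t 0 = 0\<close>, where
    \<open>f\<close> is \<open>x0\<close>; the second half runs through \<open>f\<close> at double
    speed.\<close>
  let ?\<phi> = "\<lambda>a::real. max 0 (2 * a - 1)"
  show "continuous_on {0..1} ?\<phi>"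
    by (intro continuous_intros)
  fix t assume t: "t \<in> topspace (hcube_top n)"
  have "t(0 := 0) \<in> hcube_boundary n"
    using t \<open>n \<ge> 1\<close> by (simp add: hcube_upd_boundary)
  then have "f (t(0 := 0)) = x0"
    using assms by (simp add: hsph_maps_def)
  then show "f (t(0 := ?\<phi> (t 0))) = cube_concat (\<lambda>_. x0) f t"
    by (cases "t 0 \<le> 1/2") (auto simp: cube_concat_def)
qed (use assms in auto)

text \<open>Running \<open>f\<close> backwards and then forwards is the reparametrisation by
  \<open>\<bar>1 - 2 * a\<bar>\<close>, which starts and ends at 1 and so deforms with fixed ends to
  the constant 1. For this reason \<open>hrel_homotopic_reparam\<close> allows both ends to have the
  same value.\<close>

lemma hrel_homotopic_left_inverse:
  assumes "n \<ge> 1" "f \<in> hsph_maps n X x0"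
  shows "hrel_homotopic n X x0 (cube_concat (\<lambda>t. f (t(0 := 1 - t 0))) f) (\<lambda>_. x0)"
proof -
  have "hrel_homotopic n X x0 (\<lambda>t. f (t(0 := \<bar>1 - 2 * t 0\<bar>))) (\<lambda>t. f (t(0 := 1)))"
    by (rule hrel_homotopic_reparam) (use assms in \<open>auto intro!: continuous_intros\<close>)
  moreover have "(\<lambda>t. f (t(0 := \<bar>1 - 2 * t 0\<bar>))) = cube_concat (\<lambda>t. f (t(0 := 1 - t 0))) f"
    by (auto simp: cube_concat_def fun_eq_iff)
  moreover have "hrel_homotopic n X x0 (\<lambda>t. f (t(0 := 1))) (\<lambda>_. x0)"
  proof (rule hrel_homotopic_equal)
    fix t assume "t \<in> topspace (hcube_top n)"
    then have "t(0 := 1) \<in> hcube_boundary n"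
      using \<open>n \<ge> 1\<close> by (simp add: hcube_upd_boundary)
    then show "f (t(0 := 1)) = x0"
      using assms by (simp add: hsph_maps_def)
  qed (rule conjunct2[OF hrel_homotopic_imp_hsph[OF calculation(1)]])
  ultimately show ?thesis
    by (simp add: hrel_homotopic_trans)
qed

lemma group_homotopy_group:
  assumes "n \<ge> 1" "x0 \<in> topspace X"
  shows "group (homotopy_group n X x0)"
proof (rule groupI)
  let ?G = "homotopy_group n X x0" and ?c = "hclass n X x0"
  have car: "carrier ?G = ?c ` hsph_maps n X x0" and one: "\<one>\<^bsub>?G\<^esub> = ?c (\<lambda>_. x0)"
    by (simp_all add: homotopy_group_def)
  note sims = car one mult_hclass assms[simplified] hsph_maps_concat hsph_const
  show "x \<otimes>\<^bsub>?G\<^esub> y \<in> carrier ?G" if "x \<in> carrier ?G" "y \<in> carrier ?G" for x y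
    using that by (auto simp: sims)
  show "\<one>\<^bsub>?G\<^esub> \<in> carrier ?G"
    by (auto simp: sims)
  show "x \<otimes>\<^bsub>?G\<^esub> y \<otimes>\<^bsub>?G\<^esub> z = x \<otimes>\<^bsub>?G\<^esub> (y \<otimes>\<^bsub>?G\<^esub> z)"
    if "x \<in> carrier ?G" "y \<in> carrier ?G" "z \<in> carrier ?G" for x y z
  proof -
    from that car obtain f g h where "f \<in> hsph_maps n X x0" "g \<in> hsph_maps n X x0" "h \<in> hsph_maps n X x0"
      and "x = ?c f" "y = ?c g" "z = ?c h"
      by auto
    moreover from this have "?c (cube_concat (cube_concat f g) h) = ?c (cube_concat f (cube_concat g h))"
      using hclass_eqI hrel_homotopic_assoc assms(1) by metis
    ultimately show ?thesis
      by (simp add: sims)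
  qed
  show "\<one>\<^bsub>?G\<^esub> \<otimes>\<^bsub>?G\<^esub> x = x" if "x \<in> carrier ?G" for x
  proof -
    from that car obtain f where "f \<in> hsph_maps n X x0" "x = ?c f"
      by auto
    then show ?thesis
      using hclass_eqI[OF hrel_homotopic_left_unit[OF \<open>n \<ge> 1\<close>, of f X x0]] by (simp add: sims)
  qed
  show "\<exists>y\<in>carrier ?G. y \<otimes>\<^bsub>?G\<^esub> x = \<one>\<^bsub>?G\<^esub>" if "x \<in> carrier ?G" for x
  proof -
    from that car obtain f where f: "f \<in> hsph_maps n X x0" "x = ?c f"
      by auto
    have "(\<lambda>t. f (t(0 := 1 - t 0))) \<in> hsph_maps n X x0"
      by (rule hsph_maps_reparam) (use assms f in \<open>auto intro!: continuous_intros\<close>)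
    then show ?thesis
      using f hclass_eqI[OF hrel_homotopic_left_inverse[OF \<open>n \<ge> 1\<close> f(1)]]
      by (intro bexI[of _ "?c (\<lambda>t. f (t(0 := 1 - t 0)))"]) (simp_all add: sims)
  qed
qed

subsection \<open>The quotient map from the cube to the sphere\<close>

text \<open>Expanding the square cancels the constant term, because the sphere passes through the
  origin. The resulting equation is linear in \<open>k\<close>: away from the origin the index can
  be read off as \<open>2 * r 0\<close> divided by the squared norm. Uniqueness of the radius and
  openness of the cells rest on this.\<close>

lemma hsphere_iff:
  assumes "k \<ge> 1"
  shows "r \<in> hsphere n k \<longleftrightarrow> (\<forall>i>n. r i = 0) \<and> real k * (\<Sum>i\<le>n. (r i)\<^sup>2) = 2 * r 0"
proof -
  have "(\<Sum>i\<le>n. (r i)\<^sup>2) = (r 0)\<^sup>2 + (\<Sum>i=1..n. (r i)\<^sup>2)"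
    by (simp add: sum.atLeast1_atMost_eq sum.atMost_shift)
  moreover have "(r 0 - 1 / real k)\<^sup>2 + S = (1 / real k)\<^sup>2 \<longleftrightarrow> real k * ((r 0)\<^sup>2 + S) = 2 * r 0" for S
  proof -
    have "(r 0 - 1 / real k)\<^sup>2 + S = (1 / real k)\<^sup>2 \<longleftrightarrow> (r 0)\<^sup>2 + S = 2 * r 0 / real k"
      by (auto simp: power2_diff power_divide)
    also have "\<dots> \<longleftrightarrow> real k * ((r 0)\<^sup>2 + S) = 2 * r 0"
      using assms by (auto simp: field_simps)
    finally show ?thesis .
  qed
  ultimately show ?thesis
    by (simp add: hsphere_def)
qed

lemma zero_in_hsphere: "k \<ge> 1 \<Longrightarrow> (\<lambda>_. 0) \<in> hsphere n k"
  by (simp add: hsphere_iff)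

lemma hsphere_sum_squares_pos:
  assumes "k \<ge> 1" "r \<in> hsphere n k" "r \<noteq> (\<lambda>_. 0)"
  shows "(\<Sum>i\<le>n. (r i)\<^sup>2) > 0"
proof -
  obtain i where i: "r i \<noteq> 0" using assms(3) by auto
  then have "i \<le> n"
    using assms by (auto simp: hsphere_iff not_le[symmetric])
  then show ?thesis
    by (intro sum_pos2[of _ i]) (use i in auto)
qed

lemma hsphere_unique_radius:
  assumes "k \<ge> 1" "m \<ge> 1" "r \<in> hsphere n k" "r \<in> hsphere n m" "r \<noteq> (\<lambda>_. 0)"
  shows "k = m"
proof -
  have "real k * (\<Sum>i\<le>n. (r i)\<^sup>2) = real m * (\<Sum>i\<le>n. (r i)\<^sup>2)"
    using assms by (simp add: hsphere_iff)
  then show ?thesis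
    using hsphere_sum_squares_pos[OF assms(1,3,5)] by simp
qed

text \<open>The bound is the diameter of a sphere of radius \<open>1/k\<close> through the origin.
  First \<open>k * r 0 \<le> 2\<close>, then
  \<open>(k * r i)\<^sup>2 \<le> 2 * (k * r 0)\<close>.\<close>

lemma hsphere_coord_bound:
  assumes "k \<ge> 1" "r \<in> hsphere n k"
  shows "\<bar>r i\<bar> \<le> 2 / real k"
proof (cases "i \<le> n")
  case True
  have k: "real k * (\<Sum>i\<le>n. (r i)\<^sup>2) = 2 * r 0"
    using assms by (simp add: hsphere_iff)
  have le: "(r j)\<^sup>2 \<le> (\<Sum>i\<le>n. (r i)\<^sup>2)" if "j \<le> n" for j
    by (rule member_le_sum) (use that in auto)
  have 0: "r 0 \<ge> 0"
  proof -
    have "0 \<le> real k * (\<Sum>i\<le>n. (r i)\<^sup>2)"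
      by (simp add: sum_nonneg)
    with k show ?thesis by simp
  qed
  have "real k * (r 0)\<^sup>2 \<le> 2 * r 0"
    using le[of 0] k by (metis mult_left_mono of_nat_0_le_iff zero_le)
  then have r0: "real k * r 0 \<le> 2"
    using 0 by (cases "r 0 = 0") (auto simp: power2_eq_square)
  have "real k * (r i)\<^sup>2 \<le> 2 * r 0"
    using le[OF True] k by (metis mult_left_mono of_nat_0_le_iff)
  then have "real k * (real k * (r i)\<^sup>2) \<le> real k * (2 * r 0)"
    by (intro mult_left_mono) auto
  also have "\<dots> \<le> 2 * 2"
    using r0 by simp
  finally have "(real k * r i)\<^sup>2 \<le> 2\<^sup>2"
    by (simp add: power2_eq_square algebra_simps)
  then have "\<bar>real k * r i\<bar> \<le> 2"
    using abs_le_square_iff[of "real k * r i" 2] by simp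
  then show ?thesis
    using assms(1) by (simp add: abs_mult field_simps)
next
  case False
  then show ?thesis
    using assms by (simp add: hsphere_iff)
qed

text \<open>The sup norm of the centred point \<open>2 * t - 1\<close>, the \<open>s\<close> of
  \<open>cube_to_sphere\<close>. It sets the polar angle \<open>pi * s\<close>, while division by
  the Euclidean norm \<open>cube_norm\<close> sets the direction.\<close>

definition cube_radius :: "nat \<Rightarrow> (nat \<Rightarrow> real) \<Rightarrow> real" where
  "cube_radius n t = Max ((\<lambda>i. \<bar>2 * t i - 1\<bar>) ` {..<n})"

definition cube_norm :: "nat \<Rightarrow> (nat \<Rightarrow> real) \<Rightarrow> real" where
  "cube_norm n t = sqrt (\<Sum>i<n. (2 * t i - 1)\<^sup>2)"

lemma cube_to_sphere_0: "cube_to_sphere n k t 0 = (1 + cos (pi * cube_radius n t)) / real k"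
  by (simp add: cube_to_sphere_def cube_radius_def Let_def)

lemma cube_to_sphere_Suc:
  "i < n \<Longrightarrow> cube_to_sphere n k t (Suc i) = sin (pi * cube_radius n t) * (2 * t i - 1) / (real k * cube_norm n t)"
  by (simp add: cube_to_sphere_def cube_radius_def cube_norm_def Let_def)

lemma cube_to_sphere_beyond: "i > n \<Longrightarrow> cube_to_sphere n k t i = 0"
  by (simp add: cube_to_sphere_def Let_def)

lemma coord_cases: obtains "j = 0" | i where "j = Suc i" "i < n" | "j > (n::nat)"
  by (cases j) (auto, metis not_less_eq)

lemma cube_radius_upper: "i < n \<Longrightarrow> \<bar>2 * t i - 1\<bar> \<le> cube_radius n t"
  unfolding cube_radius_def by (rule Max_ge) auto

lemma cube_radius_attained:
  assumes "n \<ge> 1"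
  obtains i where "i < n" "cube_radius n t = \<bar>2 * t i - 1\<bar>"
proof -
  have "cube_radius n t \<in> (\<lambda>i. \<bar>2 * t i - 1\<bar>) ` {..<n}"
    unfolding cube_radius_def by (rule Max_in) (use assms in \<open>auto simp: lessThan_empty_iff\<close>)
  then show thesis using that by auto
qed

lemma cube_radius_bounds:
  assumes "n \<ge> 1" "t \<in> PiE {..<n} (\<lambda>_. {0..1})"
  shows "0 \<le> cube_radius n t" "cube_radius n t \<le> 1"
proof -
  obtain i where "i < n" "cube_radius n t = \<bar>2 * t i - 1\<bar>"
    using cube_radius_attained[OF assms(1)] .
  then show "0 \<le> cube_radius n t" "cube_radius n t \<le> 1"
    using hcube_coord[OF assms(2), of i] by auto
qed

lemma cube_radius_1_iff:
  assumes "n \<ge> 1" "t \<in> PiE {..<n} (\<lambda>_. {0..1})"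
  shows "cube_radius n t = 1 \<longleftrightarrow> t \<in> hcube_boundary n"
proof
  assume 1: "cube_radius n t = 1"
  obtain i where i: "i < n" "cube_radius n t = \<bar>2 * t i - 1\<bar>"
    using cube_radius_attained[OF assms(1)] .
  then have "t i = 0 \<or> t i = 1"
    using 1 by auto
  then show "t \<in> hcube_boundary n"
    using i(1) assms(2) unfolding hcube_boundary_iff by blast
next
  assume "t \<in> hcube_boundary n"
  then obtain i where "i < n" "t i = 0 \<or> t i = 1"
    by (auto simp: hcube_boundary_iff)
  then have "1 \<le> cube_radius n t"
    using cube_radius_upper[of i n t] by auto
  then show "cube_radius n t = 1"
    using cube_radius_bounds[OF assms] by simp
qed

lemma cube_norm_upper: "i < n \<Longrightarrow> \<bar>2 * t i - 1\<bar> \<le> cube_norm n t"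
  unfolding cube_norm_def
  by (rule real_le_rsqrt) (auto intro!: member_le_sum[of i "{..<n}" "\<lambda>i. (2 * t i - 1)\<^sup>2"])

lemma cube_norm_nonneg: "0 \<le> cube_norm n t"
  by (simp add: cube_norm_def sum_nonneg)

lemma cube_radius_le_norm: "n \<ge> 1 \<Longrightarrow> cube_radius n t \<le> cube_norm n t"
  using cube_radius_attained cube_norm_upper by metis

lemma cube_norm_0_imp:
  assumes "n \<ge> 1" "cube_norm n t = 0"
  shows "cube_radius n t = 0"
  using cube_radius_attained[OF assms(1), of t] cube_norm_upper[of _ n t] assms(2) by (metis abs_ge_zero order_antisym)

text \<open>Relative to the centre \<open>(1/k, 0, ..., 0)\<close> the point is \<open>1/k\<close>
  times a cosine followed by the matching sine times a unit vector.\<close>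

lemma cube_to_sphere_in_hsphere:
  assumes "n \<ge> 1" "k \<ge> 1"
  shows "cube_to_sphere n k t \<in> hsphere n k"
proof -
  let ?r = "cube_to_sphere n k t"
  have "(\<Sum>i=1..n. (?r i)\<^sup>2) = (\<Sum>i<n. (sin (pi * cube_radius n t) * (2 * t i - 1) / (real k * cube_norm n t))\<^sup>2)"
    unfolding One_nat_def sum.atLeast1_atMost_eq by (rule sum.cong) (auto simp: cube_to_sphere_Suc)
  also have "\<dots> = (sin (pi * cube_radius n t) / (real k * cube_norm n t))\<^sup>2 * (\<Sum>i<n. (2 * t i - 1)\<^sup>2)"
    unfolding sum_distrib_left by (rule sum.cong) (auto simp: power_mult_distrib power_divide)
  also have "(\<Sum>i<n. (2 * t i - 1)\<^sup>2) = (cube_norm n t)\<^sup>2"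
    by (simp add: cube_norm_def sum_nonneg)
  \<comment> \<open>At the centre of the cube the quotient by the zero norm evaluates to 0; this is
    the correct value because the sine vanishes there as well.\<close>
  also have "(sin (pi * cube_radius n t) / (real k * cube_norm n t))\<^sup>2 * (cube_norm n t)\<^sup>2 = (sin (pi * cube_radius n t) / real k)\<^sup>2"
    using cube_norm_0_imp[OF assms(1), of t] by (cases "cube_norm n t = 0") (auto simp: power_divide power_mult_distrib)
  finally have "(?r 0 - 1 / real k)\<^sup>2 + (\<Sum>i=1..n. (?r i)\<^sup>2) = (cos (pi * cube_radius n t) / real k)\<^sup>2 + (sin (pi * cube_radius n t) / real k)\<^sup>2"
    by (simp add: cube_to_sphere_0 add_divide_distrib)
  also have "\<dots> = (1 / real k)\<^sup>2"
    by (simp add: power_divide flip: add_divide_distrib)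
  finally show ?thesis
    by (simp add: hsphere_def cube_to_sphere_beyond)
qed

lemma cube_to_sphere_0_iff:
  assumes "n \<ge> 1" "k \<ge> 1" "t \<in> PiE {..<n} (\<lambda>_. {0..1})"
  shows "cube_to_sphere n k t = (\<lambda>_. 0) \<longleftrightarrow> t \<in> hcube_boundary n"
proof
  assume "cube_to_sphere n k t = (\<lambda>_. 0)"
  then have "cube_to_sphere n k t 0 = 0" by simp
  then have "cos (pi * cube_radius n t) = cos pi"
    using assms(2) by (simp add: cube_to_sphere_0 add_eq_0_iff)
  then have "pi * cube_radius n t = pi"
    by (rule cos_inj_pi[rotated 4]) (use cube_radius_bounds[OF assms(1,3)] in auto)
  then show "t \<in> hcube_boundary n"
    using cube_radius_1_iff[OF assms(1,3)] by simp
next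
  assume "t \<in> hcube_boundary n"
  then have "cube_radius n t = 1"
    using cube_radius_1_iff[OF assms(1,3)] by simp
  then show "cube_to_sphere n k t = (\<lambda>_. 0)"
  proof (intro ext)
    fix j
    show "cube_to_sphere n k t j = 0"
      using \<open>cube_radius n t = 1\<close>
      by (cases rule: coord_cases[where j=j and n=n])
         (auto simp: cube_to_sphere_0 cube_to_sphere_Suc cube_to_sphere_beyond)
  qed
qed

text \<open>The coordinate 0 determines the sup norm, since the cosine is injective on
  \<open>[0, pi]\<close>. For a sup norm strictly between 0 and 1 the sine is nonzero, so the other
  coordinates determine the direction; direction and sup norm together determine the point. Sup norm
  0 leaves only the centre of the cube.\<close>

lemma cube_to_sphere_inj:
  assumes "n \<ge> 1" "k \<ge> 1" and t: "t \<in> PiE {..<n} (\<lambda>_. {0..1})" and u: "u \<in> PiE {..<n} (\<lambda>_. {0..1})"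
    and eq: "cube_to_sphere n k t = cube_to_sphere n k u" and "t \<notin> hcube_boundary n"
  shows "t = u"
proof -
  have "cos (pi * cube_radius n t) = cos (pi * cube_radius n u)"
    using fun_cong[OF eq, of 0] assms(2) by (simp add: cube_to_sphere_0)
  then have "pi * cube_radius n t = pi * cube_radius n u"
    by (rule cos_inj_pi[rotated 4]) (use cube_radius_bounds[OF assms(1) t] cube_radius_bounds[OF assms(1) u] in auto)
  then have rad: "cube_radius n u = cube_radius n t" by simp
  have coord: "2 * t i - 1 = 2 * u i - 1" if "i < n" for i
  proof (cases "cube_radius n t = 0")
    case True
    then show ?thesis
      using cube_radius_upper[OF that, of t] cube_radius_upper[OF that, of u] rad by simp
  next
    case False
    then have pos: "0 < cube_radius n t" "cube_radius n t < 1"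
      using cube_radius_bounds[OF assms(1) t] cube_radius_1_iff[OF assms(1) t] assms(6) by auto
    then have "sin (pi * cube_radius n t) > 0"
      by (intro sin_gt_zero) auto
    moreover have npos: "cube_norm n t > 0" "cube_norm n u > 0"
      using cube_radius_le_norm[OF assms(1), of t] cube_radius_le_norm[OF assms(1), of u] rad pos by linarith+
    ultimately have ratio: "(2 * t j - 1) / cube_norm n t = (2 * u j - 1) / cube_norm n u" if "j < n" for j
      using fun_cong[OF eq, of "Suc j"] that assms(2) rad by (simp add: cube_to_sphere_Suc frac_eq_eq)
    \<comment> \<open>Along a fixed direction the sup norm and the Euclidean norm are proportional,
      so equal sup norms force equal Euclidean norms. Only one inequality is proved; it is used in
      both orders.\<close>
    have le: "cube_norm n x \<le> cube_norm n y"
      if "cube_radius n x = cube_radius n y" "cube_radius n x > 0" "cube_norm n x > 0" "cube_norm n y > 0"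
        "\<And>j. j < n \<Longrightarrow> (2 * x j - 1) / cube_norm n x = (2 * y j - 1) / cube_norm n y" for x y
    proof -
      obtain j where j: "j < n" "cube_radius n y = \<bar>2 * y j - 1\<bar>"
        using cube_radius_attained[OF assms(1)] .
      have "cube_radius n y / cube_norm n y = \<bar>(2 * y j - 1) / cube_norm n y\<bar>"
        using j that by simp
      also have "\<dots> = \<bar>2 * x j - 1\<bar> / cube_norm n x"
        using that(5)[OF j(1)] that(3) by (metis abs_divide abs_of_pos)
      also have "\<dots> \<le> cube_radius n y / cube_norm n x"
        using cube_radius_upper[OF j(1), of x] that by (simp add: divide_right_mono)
      finally show ?thesis
        using that by (simp add: field_simps)
    qed
    have "cube_norm n t = cube_norm n u"
      using le[of t u] le[of u t] rad pos npos ratio by fastforce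
    then show ?thesis
      using ratio[OF \<open>i < n\<close>] npos by simp
  qed
  show ?thesis
    by (rule PiE_ext[OF t u]) (use coord in auto)
qed

text \<open>A preimage is found in polar form: the angle comes from coordinate 0 by
  \<open>arccos\<close>, and the remaining coordinates are rescaled to have the sup norm belonging
  to that angle.\<close>

lemma cube_to_sphere_surj:
  assumes "n \<ge> 1" "k \<ge> 1" and r: "r \<in> hsphere n k"
  shows "\<exists>t \<in> PiE {..<n} (\<lambda>_. {0..1}). cube_to_sphere n k t = r"
proof -
  \<comment> \<open>The cosine of the polar angle: coordinate 0 after moving the centre of the
    sphere to the origin and scaling to radius 1.\<close>
  define c where "c = real k * r 0 - 1"
  define S where "S = (\<Sum>i<n. (r (Suc i))\<^sup>2)"
  have "S \<ge> 0"
    by (simp add: S_def sum_nonneg)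
  have "(r 0 - 1 / real k)\<^sup>2 + S = (1 / real k)\<^sup>2"
    using r by (simp add: hsphere_def sum.atLeast1_atMost_eq S_def)
  then have "(real k)\<^sup>2 * ((r 0 - 1 / real k)\<^sup>2 + S) = (real k)\<^sup>2 * (1 / real k)\<^sup>2"
    by simp
  then have cS: "c\<^sup>2 + (real k)\<^sup>2 * S = 1"
    using assms(2) by (simp add: c_def distrib_left right_diff_distrib power_divide flip: power_mult_distrib)
  then have "c\<^sup>2 \<le> 1"
    using \<open>S \<ge> 0\<close> by (smt (verit) mult_nonneg_nonneg zero_le_power2)
  then have c: "-1 \<le> c" "c \<le> 1"
    by (auto simp: abs_square_le_1 abs_le_iff)
  define s where "s = arccos c / pi"
  have s: "0 \<le> s" "s \<le> 1" and cos_s: "cos (pi * s) = c"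
    using c by (auto simp: s_def arccos_lbound arccos_ubound cos_arccos)
  have "(sin (pi * s))\<^sup>2 = (real k)\<^sup>2 * S"
    using cS cos_s sin_cos_squared_add[of "pi * s"] by simp
  moreover have sin_nonneg: "sin (pi * s) \<ge> 0"
    using s by (intro sin_ge_zero) auto
  ultimately have sin_s: "sin (pi * s) = real k * sqrt S"
    by (metis of_nat_0_le_iff real_sqrt_abs real_sqrt_mult abs_of_nonneg)
  have r0: "r 0 = (1 + c) / real k"
    using assms(2) by (simp add: c_def)
  have beyond: "r i = 0" if "i > n" for i
    using r that by (simp add: hsphere_def)
  define M where "M = Max ((\<lambda>i. \<bar>r (Suc i)\<bar>) ` {..<n})"
  \<comment> \<open>If \<open>S = 0\<close> then \<open>r\<close> lies on the axis and has no
    direction; any vector of sup norm \<open>s\<close> will do, here the one with all entries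
    \<open>s\<close>. Otherwise division by the sup norm \<open>M\<close> normalises the
    direction.\<close>
  define v where "v i = (if S = 0 then s else s * r (Suc i) / M)" for i
  define t where "t = (\<lambda>i\<in>{..<n}. (1 + v i) / 2)"
  have tv: "2 * t i - 1 = v i" if "i < n" for i
    using that by (simp add: t_def add_divide_distrib)
  have M_upper: "\<bar>r (Suc i)\<bar> \<le> M" if "i < n" for i
    unfolding M_def by (rule Max_ge) (use that in auto)
  have M_pos: "M > 0" if S: "S \<noteq> 0"
  proof -
    obtain i where "i < n" "r (Suc i) \<noteq> 0"
      using S unfolding S_def by (metis (no_types, lifting) lessThan_iff sum.neutral zero_eq_power2)
    then show ?thesis using M_upper[of i] by linarith
  qed
  obtain i0 where i0: "i0 < n" "M = \<bar>r (Suc i0)\<bar>"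
  proof -
    have "M \<in> (\<lambda>i. \<bar>r (Suc i)\<bar>) ` {..<n}"
      unfolding M_def by (rule Max_in) (use assms in \<open>auto simp: lessThan_empty_iff\<close>)
    then show thesis using that by auto
  qed
  have v_le: "\<bar>v i\<bar> \<le> s" if "i < n" for i
  proof (cases "S = 0")
    case False
    have "s * \<bar>r (Suc i)\<bar> \<le> s * M"
      using M_upper[OF that] s by (intro mult_left_mono) auto
    with False show ?thesis
      using M_pos s by (simp add: v_def abs_mult pos_divide_le_eq)
  qed (use s in \<open>simp add: v_def\<close>)
  have v_i0: "\<bar>v i0\<bar> = s"
    using M_pos s i0(2) by (cases "S = 0") (auto simp: v_def abs_mult)
  have rad: "cube_radius n t = s"
    unfolding cube_radius_def
  proof (rule Max_eqI)
    show "s \<in> (\<lambda>i. \<bar>2 * t i - 1\<bar>) ` {..<n}"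
      using v_i0 i0(1) tv by (intro image_eqI[of _ _ i0]) auto
  qed (use v_le tv in auto)
  have "t \<in> PiE {..<n} (\<lambda>_. {0..1})"
  proof (rule PiE_I)
    fix i assume "i \<in> {..<n}"
    then have "i < n" by simp
    then show "t i \<in> {0..1}"
      using v_le[of i] tv[of i] s by (auto simp: abs_le_iff)
  qed (simp add: t_def)
  moreover have "cube_to_sphere n k t j = r j" for j
  proof (cases rule: coord_cases[where j=j and n=n])
    case 1
    then show ?thesis by (simp add: cube_to_sphere_0 rad cos_s r0)
  next
    case (2 i)
    show ?thesis
    proof (cases "S = 0")
      case True
      then have "(r (Suc i))\<^sup>2 = 0"
        using 2 unfolding S_def by (subst (asm) sum_nonneg_eq_0_iff) auto
      with True 2 show ?thesis
        by (simp add: cube_to_sphere_Suc rad sin_s)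
    next
      case False
      then have "S > 0" using \<open>S \<ge> 0\<close> by simp
      then have "s \<noteq> 0"
        using sin_s assms(2) by auto
      then have "s > 0" using s by simp
      have "(\<Sum>i<n. (2 * t i - 1)\<^sup>2) = (\<Sum>i<n. (s / M)\<^sup>2 * (r (Suc i))\<^sup>2)"
        by (rule sum.cong) (use False in \<open>auto simp: tv v_def power_divide power_mult_distrib\<close>)
      also have "\<dots> = (s / M)\<^sup>2 * S"
        by (simp add: S_def sum_distrib_left)
      finally have "cube_norm n t = s / M * sqrt S"
        using \<open>s > 0\<close> M_pos[OF False] by (simp add: cube_norm_def real_sqrt_mult)
      then show ?thesis
        using 2 \<open>s > 0\<close> M_pos[OF False] \<open>S > 0\<close> assms(2) False
        by (simp add: cube_to_sphere_Suc rad sin_s tv v_def)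
    qed
  next
    case 3
    then show ?thesis by (simp add: cube_to_sphere_beyond beyond)
  qed
  ultimately show ?thesis by blast
qed

section \<open>Continuity of the map from the cube to the sphere\<close>

lemma continuous_on_Max_image:
  fixes f :: "'i \<Rightarrow> 'c::topological_space \<Rightarrow> real"
  assumes "finite I" "I \<noteq> {}" "\<And>i. i \<in> I \<Longrightarrow> continuous_on S (f i)"
  shows "continuous_on S (\<lambda>x. Max ((\<lambda>i. f i x) ` I))"
  using assms
proof (induction rule: finite_ne_induct)
  case (insert i I)
  then have "continuous_on S (\<lambda>x. max (f i x) (Max ((\<lambda>i. f i x) ` I)))"
    by (intro continuous_on_max) auto
  with insert show ?case
    by simp
qed simp

text \<open>At zeros of \<open>e\<close> the junk value \<open>x / 0 = 0\<close> is the correct limit.\<close>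

lemma continuous_on_mult_bounded_quotient:
  fixes a b e :: "'c::topological_space \<Rightarrow> real"
  assumes "continuous_on S a" "continuous_on S b" "continuous_on S e"
    and le: "\<And>x. x \<in> S \<Longrightarrow> \<bar>b x\<bar> \<le> \<bar>e x\<bar>" and zero: "\<And>x. \<lbrakk>x \<in> S; e x = 0\<rbrakk> \<Longrightarrow> a x = 0"
  shows "continuous_on S (\<lambda>x. a x * b x / e x)"
  unfolding continuous_on_def
proof
  fix x assume "x \<in> S"
  have lim: "(a \<longlongrightarrow> a x) (at x within S)" "(b \<longlongrightarrow> b x) (at x within S)" "(e \<longlongrightarrow> e x) (at x within S)"
    using assms \<open>x \<in> S\<close> by (auto simp: continuous_on_def)
  show "((\<lambda>x. a x * b x / e x) \<longlongrightarrow> a x * b x / e x) (at x within S)"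
  proof (cases "e x = 0")
    case True
    have "((\<lambda>x. a x * b x / e x) \<longlongrightarrow> 0) (at x within S)"
    proof (rule Lim_null_comparison)
      show "\<forall>\<^sub>F y in at x within S. norm (a y * b y / e y) \<le> \<bar>a y\<bar>"
      proof (rule eventually_at_topological[THEN iffD2], intro exI[of _ UNIV] conjI ballI impI)
        fix y assume "y \<in> S"
        have "\<bar>b y\<bar> / \<bar>e y\<bar> \<le> 1"
          using le[OF \<open>y \<in> S\<close>] by (cases "e y = 0") (auto simp: divide_le_eq_1)
        then have "\<bar>a y\<bar> * (\<bar>b y\<bar> / \<bar>e y\<bar>) \<le> \<bar>a y\<bar> * 1"
          by (intro mult_left_mono) auto
        then show "norm (a y * b y / e y) \<le> \<bar>a y\<bar>"
          by (simp add: abs_mult abs_divide)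
      qed auto
      show "((\<lambda>y. \<bar>a y\<bar>) \<longlongrightarrow> 0) (at x within S)"
        using lim(1) zero[OF \<open>x \<in> S\<close> True] by (metis tendsto_rabs_zero)
    qed
    with True show ?thesis by simp
  next
    case False
    then show ?thesis
      by (intro tendsto_intros lim)
  qed
qed

text \<open>Only the centre of the cube is critical. There the direction is undefined but bounded,
  and the sine factor tends to 0.\<close>

lemma continuous_on_cube_to_sphere:
  assumes "n \<ge> 1" "k \<ge> 1"
  shows "continuous_on S (cube_to_sphere n k)"
proof (rule continuous_on_coordinatewise_then_product)
  fix j
  have coord: "continuous_on S (\<lambda>t :: nat \<Rightarrow> real. t i)" for i
    by (rule continuous_on_product_then_coordinatewise) (rule continuous_on_id)
  have rad: "continuous_on S (cube_radius n)"
    unfolding cube_radius_def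
    by (rule continuous_on_Max_image) (use assms in \<open>auto simp: lessThan_empty_iff intro!: continuous_intros coord\<close>)
  have norm: "continuous_on S (cube_norm n)"
    unfolding cube_norm_def by (intro continuous_intros coord)
  show "continuous_on S (\<lambda>t. cube_to_sphere n k t j)"
  proof (cases rule: coord_cases[where j=j and n=n])
    case 1
    then show ?thesis
      using assms(2) by (auto simp: cube_to_sphere_0 intro!: continuous_intros rad)
  next
    case (2 i)
    have "continuous_on S (\<lambda>t. sin (pi * cube_radius n t) * (2 * t i - 1) / (real k * cube_norm n t))"
    proof (rule continuous_on_mult_bounded_quotient)
      fix t
      have "\<bar>2 * t i - 1\<bar> \<le> 1 * cube_norm n t"
        using cube_norm_upper[OF 2(2)] by simp
      also have "\<dots> \<le> real k * cube_norm n t"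
        using assms(2) cube_norm_nonneg by (intro mult_right_mono) auto
      finally show "\<bar>2 * t i - 1\<bar> \<le> \<bar>real k * cube_norm n t\<bar>"
        by simp
      show "sin (pi * cube_radius n t) = 0" if "real k * cube_norm n t = 0"
        using that cube_norm_0_imp[OF assms(1)] assms(2) by simp
    qed (intro continuous_intros rad norm coord)+
    with 2 show ?thesis
      by (simp add: cube_to_sphere_Suc)
  next
    case 3
    then show ?thesis
      by (simp add: cube_to_sphere_beyond)
  qed
qed

subsection \<open>The weak join of the Hawaiian earrings\<close>

text \<open>A basic neighbourhood of 0 in the product topology restricts only finitely many
  coordinates, and on the \<open>k\<close>-th sphere every coordinate is bounded by
  \<open>2/k\<close>; one threshold for \<open>k\<close> therefore serves all restricted
  coordinates.\<close>

lemma finite_hsphere_not_subset: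
  assumes "open U" "(\<lambda>_. 0) \<in> U"
  shows "finite {k. k \<ge> 1 \<and> \<not> hsphere n k \<subseteq> U}"
proof -
  have "openin (product_topology (\<lambda>_. euclidean) UNIV) U"
    using assms(1) by (simp add: euclidean_product_topology)
  from product_topology_open_contains_basis[OF this assms(2)]
  obtain B where B: "(\<lambda>_. 0) \<in> (\<Pi>\<^sub>E i\<in>UNIV. B i)" "\<And>i. open (B i)"
    "finite {i. B i \<noteq> (UNIV :: real set)}" "(\<Pi>\<^sub>E i\<in>UNIV. B i) \<subseteq> U"
    by auto
  have "\<forall>\<^sub>F k in sequentially. \<forall>x. \<bar>x\<bar> \<le> 2 / real k \<longrightarrow> x \<in> B i" for i
  proof -
    have "0 \<in> B i" using B(1) by auto
    then obtain e where e: "e > 0" "ball 0 e \<subseteq> B i"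
      using B(2) openE by blast
    have "(\<lambda>k. 2 / real k) \<longlonglongrightarrow> 0"
      by (rule lim_const_over_n)
    then have "\<forall>\<^sub>F k in sequentially. 2 / real k < e"
      using e(1) by (rule order_tendstoD)
    then show ?thesis
      by (rule eventually_mono) (use e(2) in \<open>auto simp: subset_iff\<close>)
  qed
  then have "\<forall>\<^sub>F k in sequentially. \<forall>i\<in>{i. B i \<noteq> UNIV}. \<forall>x. \<bar>x\<bar> \<le> 2 / real k \<longrightarrow> x \<in> B i"
    by (intro eventually_ball_finite B(3)) auto
  then obtain N where N: "\<And>k i x. \<lbrakk>k \<ge> N; B i \<noteq> UNIV; \<bar>x\<bar> \<le> 2 / real k\<rbrakk> \<Longrightarrow> x \<in> B i"
    by (auto simp: eventually_sequentially)
  have "hsphere n k \<subseteq> U" if "k \<ge> N" "k \<ge> 1" for k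
  proof
    fix r assume "r \<in> hsphere n k"
    then have "r i \<in> B i" for i
      using N[OF that(1)] hsphere_coord_bound[OF that(2)] by (cases "B i = UNIV") auto
    then show "r \<in> U" using B(4) by auto
  qed
  then have "{k. k \<ge> 1 \<and> \<not> hsphere n k \<subseteq> U} \<subseteq> {..<N}"
    by (auto simp: not_less[symmetric])
  then show ?thesis
    using finite_subset by blast
qed

text \<open>The predicate inside \<open>hawaiian_inf\<close>, named so that
  \<open>istopology\<close> can be proved for it; only then does \<open>topology\<close> return
  these sets as the open sets.\<close>

definition hinf_open :: "(nat \<times> (nat \<Rightarrow> real)) set \<Rightarrow> bool" where
  "hinf_open U \<longleftrightarrow> U \<subseteq> hjoin_carrier \<and>
      (\<forall>n\<in>{1..}. openin (top_of_set (hawaiian n)) {r \<in> hawaiian n. hjoin_incl n r \<in> U}) \<and>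
      (hjoin_base \<in> U \<longrightarrow> finite {n\<in>{1..}. \<not> hjoin_incl n ` hawaiian n \<subseteq> U})"

lemma istopology_hinf_open: "istopology hinf_open"
  unfolding istopology_def
proof (intro conjI allI impI)
  let ?pre = "\<lambda>U n. {r \<in> hawaiian n. hjoin_incl n r \<in> U}"
  let ?bad = "\<lambda>U. {n\<in>{1..}. \<not> hjoin_incl n ` hawaiian n \<subseteq> U}"
  fix S T assume S: "hinf_open S" and T: "hinf_open T"
  have 1: "?pre (S \<inter> T) n = ?pre S n \<inter> ?pre T n" for n
    by auto
  have 2: "?bad (S \<inter> T) = ?bad S \<union> ?bad T"
    by auto
  show "hinf_open (S \<inter> T)"
    using S T unfolding hinf_open_def 1 2 by (simp add: le_infI1 openin_Int)
next
  let ?pre = "\<lambda>U n. {r \<in> hawaiian n. hjoin_incl n r \<in> U}"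
  let ?bad = "\<lambda>U. {n\<in>{1..}. \<not> hjoin_incl n ` hawaiian n \<subseteq> U}"
  fix K assume K: "\<forall>S\<in>K. hinf_open S"
  have "openin (top_of_set (hawaiian n)) (?pre (\<Union>K) n)" if "n \<in> {1..}" for n
  proof -
    have "?pre (\<Union>K) n = (\<Union>S\<in>K. ?pre S n)"
      by auto
    also have "openin (top_of_set (hawaiian n)) \<dots>"
      using K that by (intro openin_Union) (force simp: hinf_open_def)
    finally show ?thesis .
  qed
  moreover have "finite (?bad (\<Union>K))" if base: "hjoin_base \<in> \<Union>K"
  proof -
    obtain S where S: "S \<in> K" "hjoin_base \<in> S"
      using base by auto
    then have "finite (?bad S)"
      using K by (simp add: hinf_open_def)
    moreover have "?bad (\<Union>K) \<subseteq> ?bad S"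
      using S(1) by blast
    ultimately show ?thesis
      by (rule rev_finite_subset)
  qed
  moreover have "\<Union>K \<subseteq> hjoin_carrier"
    using K by (auto simp: hinf_open_def)
  ultimately show "hinf_open (\<Union>K)"
    unfolding hinf_open_def by (intro conjI ballI impI)
qed

lemma openin_hawaiian_inf: "openin hawaiian_inf U \<longleftrightarrow> hinf_open U"
proof -
  have "hawaiian_inf = topology hinf_open"
    unfolding hawaiian_inf_def hinf_open_def ..
  then show ?thesis
    by (metis istopology_hinf_open topology_inverse')
qed

lemma hjoin_incl_in_carrier: "\<lbrakk>n \<ge> 1; r \<in> hawaiian n\<rbrakk> \<Longrightarrow> hjoin_incl n r \<in> hjoin_carrier"
  by (auto simp: hjoin_carrier_def)

lemma topspace_hawaiian_inf [simp]: "topspace hawaiian_inf = hjoin_carrier"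
proof -
  have "hinf_open hjoin_carrier"
    by (simp add: hinf_open_def hjoin_incl_in_carrier image_subset_iff cong: conj_cong)
  then show ?thesis
    unfolding topspace_def openin_hawaiian_inf by (auto simp: hinf_open_def)
qed

lemma hjoin_base_in_carrier [simp]: "hjoin_base \<in> hjoin_carrier"
  by (simp add: hjoin_carrier_def)

lemma hjoin_incl_eq_base_iff: "n \<ge> 1 \<Longrightarrow> hjoin_incl n r = hjoin_base \<longleftrightarrow> r = (\<lambda>_. 0)"
  by (auto simp: hjoin_incl_def hjoin_base_def)

lemma continuous_map_hjoin_incl:
  "n \<ge> 1 \<Longrightarrow> continuous_map (top_of_set (hawaiian n)) hawaiian_inf (hjoin_incl n)"
  by (simp add: continuous_map_def openin_hawaiian_inf hinf_open_def hjoin_incl_in_carrier)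

lemma hjoin_carrier_cases:
  assumes "p \<in> hjoin_carrier"
  obtains "p = hjoin_base" | n r where "n \<ge> 1" "r \<in> hawaiian n" "r \<noteq> (\<lambda>_. 0)" "p = (n, r)"
proof (cases "p = hjoin_base")
  case False
  with assms obtain n r where "n \<ge> 1" "r \<in> hawaiian n" "p = hjoin_incl n r"
    by (auto simp: hjoin_carrier_def)
  with False show thesis
    by (intro that(2)[of n r]) (auto simp: hjoin_incl_def)
qed (rule that(1))

text \<open>The projection that collapses every earring except the \<open>n\<close>-th to the
  origin. Any neighbourhood of the origin pulls back to a set containing all other earrings, so the
  exceptional indices lie in \<open>{n}\<close>.\<close>

lemma continuous_map_hjoin_component:
  "continuous_map hawaiian_inf euclidean (\<lambda>p. if fst p = n then snd p else (\<lambda>_. 0))"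
  unfolding continuous_map_def openin_hawaiian_inf topspace_hawaiian_inf
proof (intro conjI allI impI)
  let ?c = "\<lambda>p :: nat \<times> (nat \<Rightarrow> real). if fst p = n then snd p else (\<lambda>_. 0)"
  fix U :: "(nat \<Rightarrow> real) set" assume "openin euclidean U"
  then have U: "open U" by simp
  have c_incl: "?c (hjoin_incl m r) = (if m = n then r else (\<lambda>_. 0))" if "m \<ge> 1" for m r
    by (auto simp: hjoin_incl_def hjoin_base_def)
  show "hinf_open {p \<in> hjoin_carrier. ?c p \<in> U}"
    unfolding hinf_open_def
  proof (intro conjI ballI impI)
    fix m :: nat assume "m \<in> {1..}"
    then have "{r \<in> hawaiian m. hjoin_incl m r \<in> {p \<in> hjoin_carrier. ?c p \<in> U}} =
        {r \<in> hawaiian m. (if m = n then r else (\<lambda>_. 0)) \<in> U}"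
      using c_incl[of m] by (auto simp: hjoin_incl_in_carrier simp del: split_paired_All)
    also have "\<dots> = (if m = n then hawaiian m \<inter> U else if (\<lambda>_. 0) \<in> U then hawaiian m else {})"
      by auto
    finally show "openin (top_of_set (hawaiian m)) {r \<in> hawaiian m. hjoin_incl m r \<in> {p \<in> hjoin_carrier. ?c p \<in> U}}"
      using U by (simp add: openin_open_Int)
  next
    assume "hjoin_base \<in> {p \<in> hjoin_carrier. ?c p \<in> U}"
    then have "(\<lambda>_. 0) \<in> U"
      by (auto simp: hjoin_base_def split: if_splits)
    then have "hjoin_incl m ` hawaiian m \<subseteq> {p \<in> hjoin_carrier. ?c p \<in> U}" if "m \<ge> 1" "m \<noteq> n" for m
      using that c_incl[OF that(1)] by (simp add: image_subset_iff hjoin_incl_in_carrier)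
    then have "{m \<in> {1..}. \<not> hjoin_incl m ` hawaiian m \<subseteq> {p \<in> hjoin_carrier. ?c p \<in> U}} \<subseteq> {n}"
      by force
    then show "finite {m \<in> {1..}. \<not> hjoin_incl m ` hawaiian m \<subseteq> {p \<in> hjoin_carrier. ?c p \<in> U}}"
      using finite_subset by blast
  qed auto
qed simp

text \<open>The projections to the single earrings jointly separate points. The Hausdorff property
  is needed to make compact images of cubes closed in the gluing argument.\<close>

lemma Hausdorff_hawaiian_inf: "Hausdorff_space hawaiian_inf"
proof (rule Hausdorff_space_injective_preimage)
  let ?J = "\<lambda>p n. if fst p = n then snd p else (\<lambda>_. 0 :: real)"
  show "Hausdorff_space (product_topology (\<lambda>_::nat. euclidean :: (nat \<Rightarrow> real) topology) UNIV)"
    by (simp add: Hausdorff_space_product_topology Hausdorff_space_euclidean)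
  show "continuous_map hawaiian_inf (product_topology (\<lambda>_. euclidean) UNIV) ?J"
    by (simp add: continuous_map_componentwise_UNIV continuous_map_hjoin_component)
  show "inj_on ?J (topspace hawaiian_inf)"
  proof (rule inj_onI)
    fix p p' assume p: "p \<in> topspace hawaiian_inf" "p' \<in> topspace hawaiian_inf" and eq: "?J p = ?J p'"
    \<comment> \<open>The carrier contains no pair with zero second component besides the base
      point, because \<open>hjoin_incl\<close> replaces all of these by
      \<open>hjoin_base\<close>.\<close>
    have zero: "x = hjoin_base" if "x \<in> hjoin_carrier" "snd x = (\<lambda>_. 0)" for x
      using that by (elim hjoin_carrier_cases) auto
    show "p = p'"
    proof (cases "fst p = fst p'")
      case True
      then show ?thesis
        using fun_cong[OF eq, of "fst p"] by (simp add: prod_eq_iff)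
    next
      case False
      then have "snd p = (\<lambda>_. 0)" "snd p' = (\<lambda>_. 0)"
        using fun_cong[OF eq, of "fst p"] fun_cong[OF eq, of "fst p'"] by auto
      then show ?thesis
        using p zero[of p] zero[of p'] by simp
    qed
  qed
qed

section \<open>The spheres as cells of the weak join\<close>

text \<open>The characteristic map of the cell \<open>(n, k)\<close>; it unfolds to the composite
  that occurs in \<open>hinf_concat\<close>.\<close>

definition hjoin_sphere :: "nat \<Rightarrow> nat \<Rightarrow> (nat \<Rightarrow> real) \<Rightarrow> nat \<times> (nat \<Rightarrow> real)" where
  "hjoin_sphere n k t = hjoin_incl n (cube_to_sphere n k t)"

lemma cube_to_sphere_in_hawaiian: "\<lbrakk>n \<ge> 1; k \<ge> 1\<rbrakk> \<Longrightarrow> cube_to_sphere n k t \<in> hawaiian n"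
  using cube_to_sphere_in_hsphere by (auto simp: hawaiian_def)

lemma hjoin_sphere_in_carrier: "\<lbrakk>n \<ge> 1; k \<ge> 1\<rbrakk> \<Longrightarrow> hjoin_sphere n k t \<in> hjoin_carrier"
  by (simp add: hjoin_sphere_def hjoin_incl_in_carrier cube_to_sphere_in_hawaiian)

lemma continuous_map_hjoin_sphere:
  assumes "n \<ge> 1" "k \<ge> 1"
  shows "continuous_map (hcube_top n) hawaiian_inf (hjoin_sphere n k)"
proof -
  have "continuous_map (hcube_top n) (top_of_set (hawaiian n)) (cube_to_sphere n k)"
    using assms by (simp add: hcube_top_eq continuous_map_in_subtopology continuous_on_cube_to_sphere cube_to_sphere_in_hawaiian)
  from continuous_map_compose[OF this continuous_map_hjoin_incl[OF assms(1)]]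
  show ?thesis
    by (simp add: hjoin_sphere_def[abs_def] o_def)
qed

lemma hjoin_sphere_eq_base_iff:
  assumes "n \<ge> 1" "k \<ge> 1" "t \<in> topspace (hcube_top n)"
  shows "hjoin_sphere n k t = hjoin_base \<longleftrightarrow> t \<in> hcube_boundary n"
  using assms by (simp add: hjoin_sphere_def hjoin_incl_eq_base_iff cube_to_sphere_0_iff)

lemma hjoin_sphere_boundary:
  assumes "n \<ge> 1" "k \<ge> 1" "t \<in> hcube_boundary n"
  shows "hjoin_sphere n k t = hjoin_base"
  using assms hjoin_sphere_eq_base_iff by (auto simp: hcube_boundary_def)

text \<open>Off the base point the tag reveals \<open>n\<close>, the sphere equation reveals
  \<open>k\<close>, and the cube map is injective off the boundary.\<close>

lemma hjoin_sphere_inj: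
  assumes n: "n \<ge> 1" "k \<ge> 1" "t \<in> topspace (hcube_top n)" and m: "m \<ge> 1" "l \<ge> 1" "u \<in> topspace (hcube_top m)"
    and eq: "hjoin_sphere n k t = hjoin_sphere m l u" and nb: "hjoin_sphere n k t \<noteq> hjoin_base"
  shows "n = m \<and> k = l \<and> t = u"
proof -
  have nz: "cube_to_sphere n k t \<noteq> (\<lambda>_. 0)" "cube_to_sphere m l u \<noteq> (\<lambda>_. 0)"
    using nb eq by (auto simp: hjoin_sphere_def hjoin_incl_def)
  then have nm: "n = m" and cs: "cube_to_sphere n k t = cube_to_sphere m l u"
    using eq by (auto simp: hjoin_sphere_def hjoin_incl_def)
  have "cube_to_sphere n k t \<in> hsphere n k" "cube_to_sphere n k t \<in> hsphere n l"
    using n m cs nm by (metis cube_to_sphere_in_hsphere)+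
  then have kl: "k = l"
    using hsphere_unique_radius n m nz by blast
  then show ?thesis
    using cube_to_sphere_inj[of n k t u] n m cs nm nz cube_to_sphere_0_iff[of n k t] by auto
qed

lemma hjoin_sphere_cover:
  assumes "p \<in> hjoin_carrier" "p \<noteq> hjoin_base"
  obtains n k t where "n \<ge> 1" "k \<ge> 1" "t \<in> topspace (hcube_top n)" "p = hjoin_sphere n k t"
proof -
  obtain n r where nr: "n \<ge> 1" "r \<in> hawaiian n" "r \<noteq> (\<lambda>_. 0)" "p = (n, r)"
    using hjoin_carrier_cases[OF assms(1)] assms(2) by metis
  then obtain k where k: "k \<ge> 1" "r \<in> hsphere n k"
    by (auto simp: hawaiian_def)
  obtain t where "t \<in> PiE {..<n} (\<lambda>_. {0..1})" "cube_to_sphere n k t = r"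
    using cube_to_sphere_surj[OF nr(1) k] by auto
  then show thesis
    using that nr k by (simp add: hjoin_sphere_def hjoin_incl_def)
qed

lemma hjoin_sphere_image:
  assumes "n \<ge> 1" "k \<ge> 1"
  shows "hjoin_sphere n k ` topspace (hcube_top n) = hjoin_incl n ` hsphere n k"
  using cube_to_sphere_in_hsphere[OF assms] cube_to_sphere_surj[OF assms]
  by (force simp: hjoin_sphere_def)

text \<open>Since the base point is removed, the finiteness clause of \<open>hinf_open\<close> is
  vacuous and the preimage in every earring but the \<open>n\<close>-th is empty. Within that
  earring the integer index separates the spheres.\<close>

lemma openin_hjoin_sphere:
  assumes "n \<ge> 1" "k \<ge> 1"
  shows "openin hawaiian_inf (hjoin_sphere n k ` topspace (hcube_top n) - {hjoin_base})"
  unfolding openin_hawaiian_inf hinf_open_def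
proof (intro conjI ballI impI)
  let ?S = "hjoin_sphere n k ` topspace (hcube_top n) - {hjoin_base}"
  show "?S \<subseteq> hjoin_carrier"
    using hjoin_sphere_in_carrier[OF assms] by auto
  fix m :: nat assume "m \<in> {1..}"
  then have m: "m \<ge> 1" by simp
  let ?a = "\<lambda>r :: nat \<Rightarrow> real. \<Sum>i\<le>n. (r i)\<^sup>2"
  have S: "?S = {n} \<times> (hsphere n k - {\<lambda>_. 0})"
    unfolding hjoin_sphere_image[OF assms] using assms by (auto simp: hjoin_incl_def hjoin_base_def split: if_splits)
  show "openin (top_of_set (hawaiian m)) {r \<in> hawaiian m. hjoin_incl m r \<in> ?S}"
  proof (cases "m = n")
    case True
    \<comment> \<open>On the sphere of radius \<open>1/l\<close> one has \<open>l * \<bar>r\<bar>\<^sup>2 = 2 * r 0\<close>, so the open condition below isolates \<open>l = k\<close>.\<close>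
    have "{r \<in> hawaiian m. hjoin_incl m r \<in> ?S} =
      hawaiian n \<inter> ({r. (real k - 1) * ?a r < 2 * r 0} \<inter> {r. 2 * r 0 < (real k + 1) * ?a r})"
      (is "?L = hawaiian n \<inter> ?R")
    proof (intro Set.set_eqI iffI)
      fix r assume "r \<in> ?L"
      then have "r \<in> hawaiian n" "r \<in> hsphere n k" "r \<noteq> (\<lambda>_. 0)"
        unfolding S using True m by (auto simp: hjoin_incl_def hjoin_base_def split: if_splits)
      then show "r \<in> hawaiian n \<inter> ?R"
        using hsphere_sum_squares_pos[OF assms(2), of r n] assms(2) by (auto simp: hsphere_iff algebra_simps)
    next
      fix r assume r: "r \<in> hawaiian n \<inter> ?R"
      then obtain l where l: "l \<ge> 1" "r \<in> hsphere n l"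
        by (auto simp: hawaiian_def)
      then have eq: "real l * ?a r = 2 * r 0"
        by (simp add: hsphere_iff)
      have "(real k - 1) * ?a r < real l * ?a r" "real l * ?a r < (real k + 1) * ?a r"
        using r eq by auto
      moreover have "?a r \<ge> 0"
        by (rule sum_nonneg) auto
      ultimately have "real k - 1 < real l" "real l < real k + 1"
        by (auto simp: mult_less_cancel_right)
      then have "l = k" by linarith
      moreover have "r \<noteq> (\<lambda>_. 0)"
        using r by auto
      ultimately show "r \<in> ?L"
        unfolding S using True l r by (auto simp: hjoin_incl_def)
    qed
    moreover have "open ?R"
      by (intro open_Int open_Collect_less continuous_on_mult continuous_on_const continuous_on_sum
          continuous_on_power continuous_on_product_coordinates)
    ultimately show ?thesis
      unfolding True by (simp only: openin_open_Int)
  next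
    case False
    then have "{r \<in> hawaiian m. hjoin_incl m r \<in> ?S} = {}"
      unfolding S using assms by (auto simp: hjoin_incl_def hjoin_base_def)
    then show ?thesis
      by (simp only: openin_empty)
  qed
qed auto

text \<open>Finiteness comes in two layers: almost all earrings lie in \<open>U\<close> by the
  topology of the join, and in each remaining one almost all spheres do because their radii tend to
  0.\<close>

lemma finite_hjoin_sphere_not_subset:
  assumes "openin hawaiian_inf U" "hjoin_base \<in> U"
  shows "finite {(n, k). n \<ge> 1 \<and> k \<ge> 1 \<and> \<not> hjoin_sphere n k ` topspace (hcube_top n) \<subseteq> U}"
proof -
  have U: "hinf_open U"
    using assms(1) by (simp add: openin_hawaiian_inf)
  let ?N = "{n \<in> {1..}. \<not> hjoin_incl n ` hawaiian n \<subseteq> U}"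
  let ?K = "\<lambda>n. {k. k \<ge> 1 \<and> \<not> hjoin_incl n ` hsphere n k \<subseteq> U}"
  have "finite (?K n)" if "n \<in> ?N" for n
  proof -
    have "openin (top_of_set (hawaiian n)) {r \<in> hawaiian n. hjoin_incl n r \<in> U}"
      using U that by (auto simp: hinf_open_def)
    then obtain T where T: "open T" "{r \<in> hawaiian n. hjoin_incl n r \<in> U} = hawaiian n \<inter> T"
      by (auto simp: openin_open)
    have "(\<lambda>_. 0) \<in> hawaiian n"
      using zero_in_hsphere[of 1 n] unfolding hawaiian_def by (intro UN_I[of 1]) auto
    moreover have "hjoin_incl n (\<lambda>_. 0) \<in> U"
      using assms(2) by (simp add: hjoin_incl_def)
    ultimately have "(\<lambda>_. 0) \<in> T"
      using T(2) by blast
    then have fin: "finite {k. k \<ge> 1 \<and> \<not> hsphere n k \<subseteq> T}"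
      by (rule finite_hsphere_not_subset[OF T(1)])
    have "hjoin_incl n ` hsphere n k \<subseteq> U" if "k \<ge> 1" "hsphere n k \<subseteq> T" for k
      using that T(2) by (auto simp: hawaiian_def)
    then show ?thesis
      by (intro finite_subset[OF _ fin]) auto
  qed
  moreover have "finite ?N"
    using U assms(2) by (simp add: hinf_open_def)
  ultimately have "finite (SIGMA n:?N. ?K n)"
    by (intro finite_SigmaI) auto
  moreover have "{(n, k). n \<ge> 1 \<and> k \<ge> 1 \<and> \<not> hjoin_sphere n k ` topspace (hcube_top n) \<subseteq> U} \<subseteq> (SIGMA n:?N. ?K n)"
  proof (rule subrelI)
    fix n k :: nat assume "(n, k) \<in> {(n, k). n \<ge> 1 \<and> k \<ge> 1 \<and> \<not> hjoin_sphere n k ` topspace (hcube_top n) \<subseteq> U}"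
    then have nk: "n \<ge> 1" "k \<ge> 1" and "\<not> hjoin_sphere n k ` topspace (hcube_top n) \<subseteq> U"
      by auto
    then have "\<not> hjoin_incl n ` hsphere n k \<subseteq> U"
      by (metis hjoin_sphere_image)
    moreover have "hsphere n k \<subseteq> hawaiian n"
      using nk by (auto simp: hawaiian_def)
    ultimately show "(n, k) \<in> (SIGMA n:?N. ?K n)"
      using nk by auto
  qed
  ultimately show ?thesis
    using finite_subset by blast
qed

text \<open>A null family of cylinders over the cubes descends to the cylinder over the weak join. The
  preimage of a closed set is handled through compact images of cubes: finitely many of them
  suffice if the set misses \<open>x0\<close>; otherwise its complement is covered by the open cells.\<close>

lemma hawaiian_inf_glue:
  fixes F :: "nat \<Rightarrow> nat \<Rightarrow> real \<times> (nat \<Rightarrow> real) \<Rightarrow> 'a"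
  assumes cont: "\<And>n k. \<lbrakk>n \<ge> 1; k \<ge> 1\<rbrakk> \<Longrightarrow> continuous_map (unit_cyl n) X (F n k)"
    and bd: "\<And>n k s t. \<lbrakk>n \<ge> 1; k \<ge> 1; s \<in> {0..1}; t \<in> hcube_boundary n\<rbrakk> \<Longrightarrow> F n k (s, t) = x0"
    and null: "\<And>U. \<lbrakk>openin X U; x0 \<in> U\<rbrakk> \<Longrightarrow> finite {(n, k). n \<ge> 1 \<and> k \<ge> 1 \<and> \<not> F n k ` topspace (unit_cyl n) \<subseteq> U}"
    and x0: "x0 \<in> topspace X"
  shows "\<exists>H. continuous_map (prod_topology (top_of_set {0..1}) hawaiian_inf) X H \<and> (\<forall>s. H (s, hjoin_base) = x0) \<and>
    (\<forall>n\<ge>1. \<forall>k\<ge>1. \<forall>s\<in>{0..1}. \<forall>t\<in>topspace (hcube_top n). H (s, hjoin_sphere n k t) = F n k (s, t))"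
proof -
  \<comment> \<open>Off the base point the triple is unique, so the choice is harmless. The base
    point lies on every sphere, hence its separate treatment in \<open>H\<close>.\<close>
  define pre where "pre p = (SOME (n, k, t). n \<ge> 1 \<and> k \<ge> 1 \<and> t \<in> topspace (hcube_top n) \<and> hjoin_sphere n k t = p)" for p
  define H where "H z = (if snd z = hjoin_base then x0 else
      case pre (snd z) of (n, k, t) \<Rightarrow> F n k (fst z, t))" for z
  let ?Z = "prod_topology (top_of_set {0..1::real}) hawaiian_inf"
  have H_base: "H (s, hjoin_base) = x0" for s
    by (simp add: H_def)
  have H_sphere: "H (s, hjoin_sphere n k t) = F n k (s, t)"
    if nk: "n \<ge> 1" "k \<ge> 1" "s \<in> {0..1}" "t \<in> topspace (hcube_top n)" for n k s t
  proof (cases "hjoin_sphere n k t = hjoin_base")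
    case True
    then show ?thesis
      using nk bd hjoin_sphere_eq_base_iff by (metis H_base)
  next
    case False
    have "pre (hjoin_sphere n k t) = (n, k, t)"
      unfolding pre_def
    proof (rule some_equality)
      fix x :: "nat \<times> nat \<times> (nat \<Rightarrow> real)"
      assume "case x of (m, l, u) \<Rightarrow> m \<ge> 1 \<and> l \<ge> 1 \<and> u \<in> topspace (hcube_top m) \<and> hjoin_sphere m l u = hjoin_sphere n k t"
      then obtain m l u where x: "x = (m, l, u)" "m \<ge> 1" "l \<ge> 1" "u \<in> topspace (hcube_top m)"
        "hjoin_sphere m l u = hjoin_sphere n k t"
        by (cases x) auto
      then show "x = (n, k, t)"
        using hjoin_sphere_inj[OF nk(1,2,4) x(2-4) x(5)[symmetric] False] by simp
    qed (use nk in simp)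
    with False show ?thesis by (simp add: H_def)
  qed
  have HausZ: "Hausdorff_space ?Z"
    by (simp add: Hausdorff_space_prod_topology Hausdorff_hawaiian_inf Hausdorff_space_subtopology)
  let ?\<phi> = "\<lambda>n k z. (fst z, hjoin_sphere n k (snd z))"
  define A where "A C n k = ?\<phi> n k ` {z \<in> topspace (unit_cyl n). F n k z \<in> C}" for C n k
  have closed_A: "closedin ?Z (A C n k)" if nk: "n \<ge> 1" "k \<ge> 1" and C: "closedin X C" for C n k
  proof (rule compactin_imp_closedin[OF HausZ])
    have "compact_space (unit_cyl n)"
      by (simp add: compact_space_prod_topology compact_hcube compact_space_subtopology)
    moreover have "closedin (unit_cyl n) {z \<in> topspace (unit_cyl n). F n k z \<in> C}"
      using closedin_continuous_map_preimage[OF cont[OF nk] C] .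
    ultimately have "compactin (unit_cyl n) {z \<in> topspace (unit_cyl n). F n k z \<in> C}"
      by (rule closedin_compact_space)
    moreover have "continuous_map (unit_cyl n) ?Z (?\<phi> n k)"
      using continuous_map_compose[OF continuous_map_snd continuous_map_hjoin_sphere[OF nk]]
      by (simp add: continuous_map_pairwise o_def continuous_map_fst)
    ultimately show "compactin ?Z (A C n k)"
      unfolding A_def by (rule image_compactin)
  qed
  have A_iff: "(s, hjoin_sphere n k t) \<in> A C n k \<longleftrightarrow> F n k (s, t) \<in> C"
    if nk: "n \<ge> 1" "k \<ge> 1" "s \<in> {0..1}" "t \<in> topspace (hcube_top n)" for C n k s t
  proof
    assume "(s, hjoin_sphere n k t) \<in> A C n k"
    then obtain u where "u \<in> topspace (hcube_top n)" "F n k (s, u) \<in> C" "hjoin_sphere n k u = hjoin_sphere n k t"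
      by (auto simp: A_def)
    \<comment> \<open>The cube points \<open>u\<close> and \<open>t\<close> may differ on the
      boundary, but both \<open>F\<close> values equal the value of \<open>H\<close> at the common
      image.\<close>
    then show "F n k (s, t) \<in> C"
      using H_sphere[OF nk] H_sphere[OF nk(1-3)] by metis
  next
    assume "F n k (s, t) \<in> C"
    then show "(s, hjoin_sphere n k t) \<in> A C n k"
      unfolding A_def using nk by (intro image_eqI[of _ _ "(s, t)"]) auto
  qed
  have H_in: "H z \<in> topspace X" if "z \<in> topspace ?Z" for z
  proof -
    obtain s p where z: "z = (s, p)" "s \<in> {0..1}" "p \<in> hjoin_carrier"
      using \<open>z \<in> topspace ?Z\<close> by auto
    show ?thesis
    proof (cases "p = hjoin_base")
      case True
      then show ?thesis using z H_base x0 by simp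
    next
      case False
      then obtain n k t where nkt: "n \<ge> 1" "k \<ge> 1" "t \<in> topspace (hcube_top n)" "p = hjoin_sphere n k t"
        using hjoin_sphere_cover[OF z(3)] by metis
      have "F n k (s, t) \<in> topspace X"
        using continuous_map_image_subset_topspace[OF cont[OF nkt(1,2)]] z(2) nkt(3) by (force simp del: topspace_hcube_top)
      then show ?thesis
        using H_sphere[OF nkt(1,2) z(2) nkt(3)] nkt(4) z(1) by simp
    qed
  qed
  have "closedin ?Z {z \<in> topspace ?Z. H z \<in> C}" if C: "closedin X C" for C
  proof (cases "x0 \<in> C")
    case False
    let ?B = "{(n, k). n \<ge> 1 \<and> k \<ge> 1 \<and> \<not> F n k ` topspace (unit_cyl n) \<subseteq> topspace X - C}"
    have "finite ?B"
      by (rule null) (use C False x0 in auto)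
    have "{z \<in> topspace ?Z. H z \<in> C} = (\<Union>(n, k)\<in>?B. A C n k)"
    proof (intro Set.set_eqI iffI)
      fix z assume "z \<in> {z \<in> topspace ?Z. H z \<in> C}"
      then obtain s p where z: "z = (s, p)" "s \<in> {0..1}" "p \<in> hjoin_carrier" "H (s, p) \<in> C"
        by auto
      then have "p \<noteq> hjoin_base"
        using False H_base by auto
      then obtain n k t where nkt: "n \<ge> 1" "k \<ge> 1" "t \<in> topspace (hcube_top n)" "p = hjoin_sphere n k t"
        using hjoin_sphere_cover[OF z(3)] by metis
      then have FC: "F n k (s, t) \<in> C"
        using z H_sphere by simp
      have st: "(s, t) \<in> topspace (unit_cyl n)"
        using z(2) nkt(3) by simp
      then have "(n, k) \<in> ?B"
        using nkt(1,2) FC by blast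
      moreover have "z \<in> A C n k"
        using A_iff[OF nkt(1,2) z(2) nkt(3)] FC z(1) nkt(4) by simp
      ultimately show "z \<in> (\<Union>(n, k)\<in>?B. A C n k)"
        by blast
    next
      fix z assume "z \<in> (\<Union>(n, k)\<in>?B. A C n k)"
      then obtain n k where nk: "n \<ge> 1" "k \<ge> 1" "z \<in> A C n k"
        by blast
      then obtain s t where st: "s \<in> {0..1}" "t \<in> topspace (hcube_top n)" "F n k (s, t) \<in> C" "z = (s, hjoin_sphere n k t)"
        by (auto simp: A_def)
      then show "z \<in> {z \<in> topspace ?Z. H z \<in> C}"
        using nk H_sphere[OF nk(1,2) st(1,2)] hjoin_sphere_in_carrier[OF nk(1,2)] by simp
    qed
    also have "closedin ?Z \<dots>"
      using \<open>finite ?B\<close> closed_A[OF _ _ C] by (intro closedin_Union) auto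
    finally show ?thesis .
  next
    case True
    let ?O = "\<lambda>n k. {0..1} \<times> (hjoin_sphere n k ` topspace (hcube_top n) - {hjoin_base}) - A C n k"
    have "topspace ?Z - {z \<in> topspace ?Z. H z \<in> C} = (\<Union>n\<in>{1..}. \<Union>k\<in>{1..}. ?O n k)"
    proof (intro Set.set_eqI iffI)
      fix z assume "z \<in> topspace ?Z - {z \<in> topspace ?Z. H z \<in> C}"
      then obtain s p where z: "z = (s, p)" "s \<in> {0..1}" "p \<in> hjoin_carrier" "H (s, p) \<notin> C"
        by auto
      then have "p \<noteq> hjoin_base"
        using True H_base by auto
      then obtain n k t where nkt: "n \<ge> 1" "k \<ge> 1" "t \<in> topspace (hcube_top n)" "p = hjoin_sphere n k t"
        using hjoin_sphere_cover[OF z(3)] by metis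
      then have "F n k (s, t) \<notin> C"
        using z H_sphere by simp
      then have "z \<notin> A C n k"
        using A_iff[OF nkt(1,2) z(2) nkt(3)] z(1) nkt(4) by simp
      then have "z \<in> ?O n k"
        using z nkt(3,4) \<open>p \<noteq> hjoin_base\<close> by blast
      then show "z \<in> (\<Union>n\<in>{1..}. \<Union>k\<in>{1..}. ?O n k)"
        using nkt(1,2) by blast
    next
      fix z assume "z \<in> (\<Union>n\<in>{1..}. \<Union>k\<in>{1..}. ?O n k)"
      then obtain n k s t where nk: "n \<ge> 1" "k \<ge> 1" "z \<notin> A C n k" "s \<in> {0..1}"
        "t \<in> topspace (hcube_top n)" "z = (s, hjoin_sphere n k t)"
        by blast
      then have "F n k (s, t) \<notin> C"
        using A_iff[OF nk(1,2,4,5)] by simp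
      then show "z \<in> topspace ?Z - {z \<in> topspace ?Z. H z \<in> C}"
        using nk H_sphere[OF nk(1,2,4,5)] hjoin_sphere_in_carrier[OF nk(1,2)] by simp
    qed
    also have "openin ?Z \<dots>"
    proof -
      have "openin ?Z (?O n k)" if "n \<ge> 1" "k \<ge> 1" for n k
        using that openin_hjoin_sphere[OF that]
        by (intro openin_diff closed_A C) (simp_all add: openin_prod_Times_iff del: topspace_hcube_top)
      then show ?thesis
        by (intro openin_Union) auto
    qed
    finally show ?thesis
      unfolding closedin_def by blast
  qed
  then have "continuous_map ?Z X H"
    using H_in unfolding continuous_map_closedin Pi_iff by blast
  then show ?thesis
    using H_base H_sphere by (intro exI[of _ H]) simp
qed

subsection \<open>Restriction to the spheres\<close>

lemma hinf_maps_restrict: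
  assumes "n \<ge> 1" "k \<ge> 1" "f \<in> hinf_maps X x0"
  shows "(\<lambda>t. f (hjoin_sphere n k t)) \<in> hsph_maps n X x0"
  using assms continuous_map_compose[OF continuous_map_hjoin_sphere[OF assms(1,2)], of X f]
  by (simp add: hinf_maps_def hsph_maps_def o_def hjoin_sphere_boundary)

lemma hrel_homotopic_restrict:
  assumes nk: "n \<ge> 1" "k \<ge> 1" and "homotopic_with (\<lambda>h. h hjoin_base = x0) hawaiian_inf X f g"
  shows "hrel_homotopic n X x0 (\<lambda>t. f (hjoin_sphere n k t)) (\<lambda>t. g (hjoin_sphere n k t))"
proof -
  have "homotopic_with (\<lambda>h. \<forall>t\<in>hcube_boundary n. h t = x0) (hcube_top n) X (f \<circ> hjoin_sphere n k) (g \<circ> hjoin_sphere n k)"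
    by (rule homotopic_with_compose_continuous_map_right[OF assms(3) continuous_map_hjoin_sphere[OF nk]])
       (use hjoin_sphere_boundary[OF nk] in auto)
  then show ?thesis
    by (simp add: hrel_homotopic_def o_def)
qed

lemma hinf_maps_null:
  assumes f: "f \<in> hinf_maps X x0" and U: "openin X U" "x0 \<in> U"
  shows "finite {(n, k). n \<ge> 1 \<and> k \<ge> 1 \<and> \<not> (\<lambda>t. f (hjoin_sphere n k t)) ` topspace (hcube_top n) \<subseteq> U}"
proof -
  let ?V = "{p \<in> topspace hawaiian_inf. f p \<in> U}"
  have "openin hawaiian_inf ?V"
    using f U(1) by (intro openin_continuous_map_preimage[of _ X]) (simp_all add: hinf_maps_def)
  moreover have "hjoin_base \<in> ?V"
    using f U(2) by (simp add: hinf_maps_def)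
  ultimately have "finite {(n, k). n \<ge> 1 \<and> k \<ge> 1 \<and> \<not> hjoin_sphere n k ` topspace (hcube_top n) \<subseteq> ?V}"
    by (rule finite_hjoin_sphere_not_subset)
  then show ?thesis
    by (rule rev_finite_subset) blast
qed

text \<open>The case of cylinders that do not depend on the parameter, followed by restriction to
  the slice at 0.\<close>

lemma hinf_maps_glue:
  assumes F: "\<And>n k. \<lbrakk>n \<ge> 1; k \<ge> 1\<rbrakk> \<Longrightarrow> F n k \<in> hsph_maps n X x0"
    and null: "\<And>U. \<lbrakk>openin X U; x0 \<in> U\<rbrakk> \<Longrightarrow> finite {(n, k). n \<ge> 1 \<and> k \<ge> 1 \<and> \<not> F n k ` topspace (hcube_top n) \<subseteq> U}"
    and x0: "x0 \<in> topspace X"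
  shows "\<exists>h \<in> hinf_maps X x0. \<forall>n\<ge>1. \<forall>k\<ge>1. \<forall>t\<in>topspace (hcube_top n). h (hjoin_sphere n k t) = F n k t"
proof -
  have "\<exists>H. continuous_map (prod_topology (top_of_set {0..1::real}) hawaiian_inf) X H \<and> (\<forall>s. H (s, hjoin_base) = x0) \<and>
    (\<forall>n\<ge>1. \<forall>k\<ge>1. \<forall>s\<in>{0..1}. \<forall>t\<in>topspace (hcube_top n). H (s, hjoin_sphere n k t) = (F n k \<circ> snd) (s, t))"
  proof (rule hawaiian_inf_glue[where F="\<lambda>n k. F n k \<circ> snd" and X=X and ?x0.0=x0])
    fix n k :: nat assume nk: "n \<ge> 1" "k \<ge> 1"
    show "continuous_map (unit_cyl n) X (F n k \<circ> snd)"
      using F[OF nk] by (intro continuous_map_compose[OF continuous_map_snd]) (simp add: hsph_maps_def)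
    show "(F n k \<circ> snd) (s, t) = x0" if "t \<in> hcube_boundary n" for s t
      using F[OF nk] that by (simp add: hsph_maps_def)
  next
    fix U assume "openin X U" "x0 \<in> U"
    moreover have "(F n k \<circ> snd) ` topspace (unit_cyl n) = F n k ` topspace (hcube_top n)" for n k
      unfolding image_comp[symmetric] topspace_prod_topology by (simp add: snd_image_times)
    ultimately show "finite {(n, k). n \<ge> 1 \<and> k \<ge> 1 \<and> \<not> (F n k \<circ> snd) ` topspace (unit_cyl n) \<subseteq> U}"
      using null by simp
  qed (rule x0)
  then obtain H where H: "continuous_map (prod_topology (top_of_set {0..1::real}) hawaiian_inf) X H"
    "\<forall>s. H (s, hjoin_base) = x0"
    "\<forall>n\<ge>1. \<forall>k\<ge>1. \<forall>s\<in>{0..1}. \<forall>t\<in>topspace (hcube_top n). H (s, hjoin_sphere n k t) = (F n k \<circ> snd) (s, t)"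
    by blast
  have "continuous_map hawaiian_inf (prod_topology (top_of_set {0..1::real}) hawaiian_inf) (\<lambda>p. (0, p))"
    by (simp add: continuous_map_pairwise o_def)
  from continuous_map_compose[OF this H(1)] have "(\<lambda>p. H (0, p)) \<in> hinf_maps X x0"
    using H(2) by (simp add: hinf_maps_def o_def)
  then show ?thesis
    using H(3) by (intro bexI[of _ "\<lambda>p. H (0, p)"]) simp_all
qed

text \<open>The \<open>SOME\<close> in the definition has a witness because the spherewise
  concatenations again form a null family: a bad pair is bad for \<open>f\<close> or for
  \<open>g\<close>.\<close>

lemma hinf_concat:
  assumes f: "f \<in> hinf_maps X x0" and g: "g \<in> hinf_maps X x0" and x0: "x0 \<in> topspace X"
  shows "hinf_concat X x0 f g \<in> hinf_maps X x0"
    and "\<lbrakk>n \<ge> 1; k \<ge> 1; t \<in> topspace (hcube_top n)\<rbrakk> \<Longrightarrow> hinf_concat X x0 f g (hjoin_sphere n k t) =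
      cube_concat (\<lambda>t. f (hjoin_sphere n k t)) (\<lambda>t. g (hjoin_sphere n k t)) t"
proof -
  let ?f = "\<lambda>n k t. f (hjoin_sphere n k t)" and ?g = "\<lambda>n k t. g (hjoin_sphere n k t)"
  let ?P = "\<lambda>h. h \<in> hinf_maps X x0 \<and> (\<forall>n\<in>{1..}. \<forall>k\<in>{1..}. \<forall>t\<in>topspace (hcube_top n).
       h (hjoin_sphere n k t) = cube_concat (?f n k) (?g n k) t)"
  have "\<exists>h \<in> hinf_maps X x0. \<forall>n\<ge>1. \<forall>k\<ge>1. \<forall>t\<in>topspace (hcube_top n).
      h (hjoin_sphere n k t) = cube_concat (?f n k) (?g n k) t"
  proof (rule hinf_maps_glue[where F="\<lambda>n k. cube_concat (?f n k) (?g n k)" and X=X and ?x0.0=x0])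
    show "cube_concat (?f n k) (?g n k) \<in> hsph_maps n X x0" if "n \<ge> 1" "k \<ge> 1" for n k
      using that f g by (intro hsph_maps_concat hinf_maps_restrict)
    fix U assume U: "openin X U" "x0 \<in> U"
    let ?bad = "\<lambda>F. {(n, k). n \<ge> 1 \<and> k \<ge> 1 \<and> \<not> F n k ` topspace (hcube_top n) \<subseteq> U}"
    have "?bad (\<lambda>n k. cube_concat (?f n k) (?g n k)) \<subseteq> ?bad ?f \<union> ?bad ?g"
    proof (rule subrelI)
      fix n k assume "(n, k) \<in> ?bad (\<lambda>n k. cube_concat (?f n k) (?g n k))"
      then obtain t where nk: "n \<ge> 1" "k \<ge> 1" and t: "t \<in> topspace (hcube_top n)" "cube_concat (?f n k) (?g n k) t \<notin> U"
        by blast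
      then have "\<not> ?f n k ` topspace (hcube_top n) \<subseteq> U \<or> \<not> ?g n k ` topspace (hcube_top n) \<subseteq> U"
        using cube_concat_in_range[OF nk(1) t(1), of "?f n k" "?g n k"] by blast
      then show "(n, k) \<in> ?bad ?f \<union> ?bad ?g"
        using nk by simp
    qed
    moreover have "finite (?bad ?f \<union> ?bad ?g)"
      using hinf_maps_null[OF f U] hinf_maps_null[OF g U] by (rule finite_UnI)
    ultimately show "finite (?bad (\<lambda>n k. cube_concat (?f n k) (?g n k)))"
      by (rule finite_subset)
  qed (rule x0)
  then have "\<exists>h. ?P h"
    by auto
  then have "?P (SOME h. ?P h)"
    by (rule someI_ex)
  moreover have "(SOME h. ?P h) = hinf_concat X x0 f g"
    unfolding hinf_concat_def hjoin_sphere_def o_def ..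
  ultimately have P: "?P (hinf_concat X x0 f g)"
    by simp
  then show "hinf_concat X x0 f g \<in> hinf_maps X x0"
    by simp
  show "hinf_concat X x0 f g (hjoin_sphere n k t) = cube_concat (?f n k) (?g n k) t"
    if "n \<ge> 1" "k \<ge> 1" "t \<in> topspace (hcube_top n)"
    using P that by simp
qed

section \<open>Small homotopies near the base point\<close>

lemma hsph_maps_subtopology:
  assumes "f \<in> hsph_maps n X x0" "f ` topspace (hcube_top n) \<subseteq> V"
  shows "f \<in> hsph_maps n (subtopology X V) x0"
  using assms by (simp add: hsph_maps_def continuous_map_in_subtopology image_subset_iff_funcset)

text \<open>The neighbourhood is shrunk to an open one so that \<open>hinf_maps_null\<close> applies
  to it; maps into the smaller set are in particular maps into the original one.\<close>

lemma locally_infinite_connectedD: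
  assumes "locally_infinite_connected X x0" "openin X U" "x0 \<in> U"
  obtains W where "openin X W" "x0 \<in> W"
    "\<And>n f. \<lbrakk>n \<ge> 1; f \<in> hsph_maps n X x0; f ` topspace (hcube_top n) \<subseteq> W\<rbrakk> \<Longrightarrow>
      hrel_homotopic n (subtopology X U) x0 f (\<lambda>_. x0)"
proof -
  obtain V W where W: "openin X W" "x0 \<in> W" "W \<subseteq> V"
    and V: "\<And>n f. \<lbrakk>n \<in> {1..}; f \<in> hsph_maps n (subtopology X V) x0\<rbrakk> \<Longrightarrow> hrel_homotopic n (subtopology X U) x0 f (\<lambda>_. x0)"
    using assms unfolding locally_infinite_connected_def by metis
  show thesis
  proof (rule that[OF W(1,2)])
    fix n f assume "n \<ge> 1" "f \<in> hsph_maps n X x0" "f ` topspace (hcube_top n) \<subseteq> W"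
    then show "hrel_homotopic n (subtopology X U) x0 f (\<lambda>_. x0)"
      using W(3) by (intro V hsph_maps_subtopology) auto
  qed
qed

text \<open>Partial intersections of an enumeration of the base. Nesting matters because a homotopy
  inside \<open>U m\<close> then lies in every \<open>U j\<close> with
  \<open>j \<le> m\<close>.\<close>

lemma first_countable_at_decreasing:
  assumes "first_countable_at X x0" "x0 \<in> topspace X"
  obtains U :: "nat \<Rightarrow> 'a set" where "\<And>j. openin X (U j)" "\<And>j. x0 \<in> U j" "\<And>i j. i \<le> j \<Longrightarrow> U j \<subseteq> U i"
    "\<And>V. \<lbrakk>openin X V; x0 \<in> V\<rbrakk> \<Longrightarrow> \<exists>j. U j \<subseteq> V"
proof -
  obtain \<B> where \<B>: "countable \<B>" "\<And>V. V \<in> \<B> \<Longrightarrow> openin X V \<and> x0 \<in> V"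
    "\<And>U. \<lbrakk>openin X U; x0 \<in> U\<rbrakk> \<Longrightarrow> \<exists>V\<in>\<B>. V \<subseteq> U"
    using assms(1) unfolding first_countable_at_def by metis
  have "\<B> \<noteq> {}"
    using \<B>(3)[of "topspace X"] assms(2) by auto
  then have range: "range (from_nat_into \<B>) = \<B>"
    using \<B>(1) by (rule range_from_nat_into)
  show thesis
  proof (rule that[of "\<lambda>j. \<Inter>i\<le>j. from_nat_into \<B> i"])
    show "openin X (\<Inter>i\<le>j. from_nat_into \<B> i)" for j
      using \<B>(2) range by (intro openin_Inter) auto
    show "x0 \<in> (\<Inter>i\<le>j. from_nat_into \<B> i)" for j
      using \<B>(2) range by auto
    show "(\<Inter>i\<le>j. from_nat_into \<B> i) \<subseteq> (\<Inter>i\<le>j'. from_nat_into \<B> i)" if "j' \<le> j" for j' j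
      using that by (intro INT_anti_mono) auto
    show "\<exists>j. (\<Inter>i\<le>j. from_nat_into \<B> i) \<subseteq> V" if V: "openin X V" "x0 \<in> V" for V
    proof -
      obtain B where "B \<in> \<B>" "B \<subseteq> V"
        using \<B>(3)[OF V] by auto
      then obtain j where "from_nat_into \<B> j = B"
        using range by (metis rangeE)
      then show ?thesis
        using \<open>B \<subseteq> V\<close> by (intro exI[of _ j]) auto
    qed
  qed
qed

text \<open>The homotopy on the sphere \<open>(n, k)\<close> is chosen inside \<open>U m\<close> with \<open>m \<le> n + k\<close> as large as
  local connectedness permits; along the spheres \<open>m\<close> tends to infinity, so these homotopies form a null family.\<close>

lemma hinf_homotopicI:
  assumes x0: "x0 \<in> topspace X" and fc: "first_countable_at X x0" and lic: "locally_infinite_connected X x0"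
    and f: "f \<in> hinf_maps X x0" and g: "g \<in> hinf_maps X x0"
    and hom: "\<And>n k. \<lbrakk>n \<ge> 1; k \<ge> 1\<rbrakk> \<Longrightarrow>
      hrel_homotopic n X x0 (\<lambda>t. f (hjoin_sphere n k t)) (\<lambda>t. g (hjoin_sphere n k t))"
  shows "homotopic_with (\<lambda>h. h hjoin_base = x0) hawaiian_inf X f g"
proof -
  let ?f = "\<lambda>n k t. f (hjoin_sphere n k t)" and ?g = "\<lambda>n k t. g (hjoin_sphere n k t)"
  obtain U :: "nat \<Rightarrow> 'a set" where U: "\<And>j. openin X (U j)" "\<And>j. x0 \<in> U j" "\<And>i j. i \<le> j \<Longrightarrow> U j \<subseteq> U i"
    "\<And>V. \<lbrakk>openin X V; x0 \<in> V\<rbrakk> \<Longrightarrow> \<exists>j. U j \<subseteq> V"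
    using first_countable_at_decreasing[OF fc x0] by metis
  have "\<exists>W. openin X W \<and> x0 \<in> W \<and> (\<forall>n h. n \<ge> 1 \<longrightarrow> h \<in> hsph_maps n X x0 \<longrightarrow> h ` topspace (hcube_top n) \<subseteq> W \<longrightarrow>
      hrel_homotopic n (subtopology X (U j)) x0 h (\<lambda>_. x0))" for j
    using locally_infinite_connectedD[OF lic U(1,2)[of j]] by metis
  then obtain W where W: "\<And>j. openin X (W j)" "\<And>j. x0 \<in> W j"
    "\<And>j n h. \<lbrakk>n \<ge> 1; h \<in> hsph_maps n X x0; h ` topspace (hcube_top n) \<subseteq> W j\<rbrakk> \<Longrightarrow>
      hrel_homotopic n (subtopology X (U j)) x0 h (\<lambda>_. x0)"
    by metis
  \<comment> \<open>The cut-off \<open>n + k\<close> keeps the set finite. Without it every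
    \<open>j\<close> would qualify when both maps are constant on the sphere, and there would be no
    maximum.\<close>
  define J where "J n k = {j. j \<le> n + k \<and> ?f n k ` topspace (hcube_top n) \<subseteq> W j \<and> ?g n k ` topspace (hcube_top n) \<subseteq> W j}" for n k
  define P where "P n k F \<longleftrightarrow> continuous_map (unit_cyl n) X F \<and> (\<forall>t. F (0, t) = ?f n k t) \<and> (\<forall>t. F (1, t) = ?g n k t) \<and>
      (\<forall>s\<in>{0..1}. \<forall>t\<in>hcube_boundary n. F (s, t) = x0) \<and> (\<forall>j\<in>J n k. F ` topspace (unit_cyl n) \<subseteq> U j)" for n k F
  have "\<exists>F. P n k F" if nk: "n \<ge> 1" "k \<ge> 1" for n k
  proof (cases "J n k = {}")
    case True
    then show ?thesis
      using hom[OF nk] unfolding P_def hrel_homotopic_def homotopic_with_def by auto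
  next
    case False
    have fin: "finite (J n k)"
      unfolding J_def by (rule finite_subset[of _ "{..n + k}"]) auto
    define m where "m = Max (J n k)"
    have "m \<in> J n k"
      unfolding m_def using fin False by (rule Max_in)
    \<comment> \<open>Both restrictions contract inside \<open>U m\<close>, so they are homotopic
      there through the constant map. The homotopy from \<open>hom\<close> could leave
      \<open>U m\<close>.\<close>
    then have "hrel_homotopic n (subtopology X (U m)) x0 (?f n k) (\<lambda>_. x0)"
      "hrel_homotopic n (subtopology X (U m)) x0 (?g n k) (\<lambda>_. x0)"
      using W(3)[OF nk(1)] hinf_maps_restrict[OF nk f] hinf_maps_restrict[OF nk g] unfolding J_def by auto
    then have "hrel_homotopic n (subtopology X (U m)) x0 (?f n k) (?g n k)"
      by (meson hrel_homotopic_sym hrel_homotopic_trans)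
    then obtain F where F: "continuous_map (unit_cyl n) (subtopology X (U m)) F" "\<forall>t. F (0, t) = ?f n k t"
      "\<forall>t. F (1, t) = ?g n k t" "\<forall>s\<in>{0..1}. \<forall>t\<in>hcube_boundary n. F (s, t) = x0"
      unfolding hrel_homotopic_def homotopic_with_def by auto
    have "F ` topspace (unit_cyl n) \<subseteq> U j" if "j \<in> J n k" for j
      using F(1) U(3)[of j m] Max_ge[OF fin that] unfolding m_def continuous_map_in_subtopology by blast
    with F show ?thesis
      unfolding P_def by (meson continuous_map_in_subtopology)
  qed
  then obtain F where "\<And>n k. \<lbrakk>n \<ge> 1; k \<ge> 1\<rbrakk> \<Longrightarrow> P n k (F n k)"
    by metis
  then have F: "\<And>n k. \<lbrakk>n \<ge> 1; k \<ge> 1\<rbrakk> \<Longrightarrow> continuous_map (unit_cyl n) X (F n k)"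
    "\<And>n k t. \<lbrakk>n \<ge> 1; k \<ge> 1\<rbrakk> \<Longrightarrow> F n k (0, t) = ?f n k t"
    "\<And>n k t. \<lbrakk>n \<ge> 1; k \<ge> 1\<rbrakk> \<Longrightarrow> F n k (1, t) = ?g n k t"
    "\<And>n k s t. \<lbrakk>n \<ge> 1; k \<ge> 1; s \<in> {0..1}; t \<in> hcube_boundary n\<rbrakk> \<Longrightarrow> F n k (s, t) = x0"
    "\<And>n k j. \<lbrakk>n \<ge> 1; k \<ge> 1; j \<in> J n k\<rbrakk> \<Longrightarrow> F n k ` topspace (unit_cyl n) \<subseteq> U j"
    unfolding P_def by blast+
  have null: "finite {(n, k). n \<ge> 1 \<and> k \<ge> 1 \<and> \<not> F n k ` topspace (unit_cyl n) \<subseteq> V}" (is "finite ?bad")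
    if V: "openin X V" "x0 \<in> V" for V
  proof -
    obtain j where j: "U j \<subseteq> V"
      using U(4)[OF V] by auto
    let ?badf = "{(n, k). n \<ge> 1 \<and> k \<ge> 1 \<and> \<not> ?f n k ` topspace (hcube_top n) \<subseteq> W j}"
    let ?badg = "{(n, k). n \<ge> 1 \<and> k \<ge> 1 \<and> \<not> ?g n k ` topspace (hcube_top n) \<subseteq> W j}"
    \<comment> \<open>If \<open>n + k \<ge> j\<close> and both restrictions lie in
      \<open>W j\<close>, then \<open>j\<close> belongs to \<open>J n k\<close> and the homotopy
      stays in \<open>U j\<close>, hence in \<open>V\<close>. Only finitely many pairs have
      \<open>n + k < j\<close>.\<close>
    have "?bad \<subseteq> {..j} \<times> {..j} \<union> (?badf \<union> ?badg)"
    proof (rule subrelI)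
      fix n k assume "(n, k) \<in> ?bad"
      then have nk: "n \<ge> 1" "k \<ge> 1" and "\<not> F n k ` topspace (unit_cyl n) \<subseteq> V"
        by auto
      then have "j \<notin> J n k"
        using F(5)[OF nk, of j] j by blast
      then have "n + k < j \<or> \<not> ?f n k ` topspace (hcube_top n) \<subseteq> W j \<or> \<not> ?g n k ` topspace (hcube_top n) \<subseteq> W j"
        by (auto simp: J_def simp del: topspace_hcube_top)
      then show "(n, k) \<in> {..j} \<times> {..j} \<union> (?badf \<union> ?badg)"
        using nk by auto
    qed
    moreover have "finite ({..j} \<times> {..j} \<union> (?badf \<union> ?badg))"
      by (intro finite_UnI finite_cartesian_product finite_atMost hinf_maps_null[OF f] hinf_maps_null[OF g] W)
    ultimately show ?thesis
      by (rule finite_subset)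
  qed
  obtain H where H: "continuous_map (prod_topology (top_of_set {0..1}) hawaiian_inf) X H"
    "\<forall>s. H (s, hjoin_base) = x0"
    "\<forall>n\<ge>1. \<forall>k\<ge>1. \<forall>s\<in>{0..1}. \<forall>t\<in>topspace (hcube_top n). H (s, hjoin_sphere n k t) = F n k (s, t)"
    using hawaiian_inf_glue[where F=F and X=X and ?x0.0=x0, OF F(1) F(4) null x0] by blast
  have hom01: "homotopic_with (\<lambda>h. h hjoin_base = x0) hawaiian_inf X (\<lambda>p. H (0, p)) (\<lambda>p. H (1, p))"
    unfolding homotopic_with_def by (intro exI[of _ H]) (simp add: H(1,2))
  have eq: "f p = H (0, p) \<and> g p = H (1, p)" if p: "p \<in> topspace hawaiian_inf" for p
  proof (cases "p = hjoin_base")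
    case True
    then show ?thesis
      using f g H(2) by (simp add: hinf_maps_def)
  next
    case False
    then obtain n k t where "n \<ge> 1" "k \<ge> 1" "t \<in> topspace (hcube_top n)" "p = hjoin_sphere n k t"
      using hjoin_sphere_cover p topspace_hawaiian_inf by metis
    then show ?thesis
      using F(2,3) H(3) by simp
  qed
  show ?thesis
    by (rule homotopic_with_eq[OF hom01]) (simp_all add: eq)
qed

section \<open>The family of homotopy classes of a map\<close>

text \<open>Both arguments are restricted because elements of the nested \<open>sum_group\<close>
  are extensional functions in each index.\<close>

definition sphere_classes :: "'a topology \<Rightarrow> 'a \<Rightarrow> (nat \<times> (nat \<Rightarrow> real) \<Rightarrow> 'a) \<Rightarrow> nat \<Rightarrow> nat \<Rightarrow> ((nat \<Rightarrow> real) \<Rightarrow> 'a) set" where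
  "sphere_classes X x0 f = (\<lambda>n\<in>{1..}. \<lambda>k\<in>{1..}. hclass n X x0 (\<lambda>t. f (hjoin_sphere n k t)))"

text \<open>One direction makes the map on homotopy classes well defined, the other makes it
  injective.\<close>

lemma sphere_classes_eq_iff:
  assumes "x0 \<in> topspace X" "first_countable_at X x0" "locally_infinite_connected X x0"
    and f: "f \<in> hinf_maps X x0" and g: "g \<in> hinf_maps X x0"
  shows "sphere_classes X x0 f = sphere_classes X x0 g \<longleftrightarrow>
    homotopic_with (\<lambda>h. h hjoin_base = x0) hawaiian_inf X f g"
proof
  assume eq: "sphere_classes X x0 f = sphere_classes X x0 g"
  show "homotopic_with (\<lambda>h. h hjoin_base = x0) hawaiian_inf X f g"
  proof (rule hinf_homotopicI[OF assms])
    fix n k :: nat assume nk: "n \<ge> 1" "k \<ge> 1"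
    have "hclass n X x0 (\<lambda>t. f (hjoin_sphere n k t)) = hclass n X x0 (\<lambda>t. g (hjoin_sphere n k t))"
      using fun_cong[OF fun_cong[OF eq, of n], of k] nk by (simp add: sphere_classes_def)
    then show "hrel_homotopic n X x0 (\<lambda>t. f (hjoin_sphere n k t)) (\<lambda>t. g (hjoin_sphere n k t))"
      using hclass_eq_iff hinf_maps_restrict nk f g by metis
  qed
next
  assume "homotopic_with (\<lambda>h. h hjoin_base = x0) hawaiian_inf X f g"
  then show "sphere_classes X x0 f = sphere_classes X x0 g"
    unfolding sphere_classes_def by (intro restrict_ext hclass_eqI hrel_homotopic_restrict) auto
qed

lemma hinf_class_eq_iff:
  assumes "f \<in> hinf_maps X x0" "g \<in> hinf_maps X x0"
  shows "hinf_class X x0 f = hinf_class X x0 g \<longleftrightarrow> homotopic_with (\<lambda>h. h hjoin_base = x0) hawaiian_inf X f g"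
proof
  assume eq: "hinf_class X x0 f = hinf_class X x0 g"
  have "g \<in> hinf_class X x0 g"
    using assms(2) by (simp add: hinf_class_def hinf_maps_def)
  then show "homotopic_with (\<lambda>h. h hjoin_base = x0) hawaiian_inf X f g"
    unfolding eq[symmetric] by (simp add: hinf_class_def)
next
  assume fg: "homotopic_with (\<lambda>h. h hjoin_base = x0) hawaiian_inf X f g"
  then show "hinf_class X x0 f = hinf_class X x0 g"
    unfolding hinf_class_def using homotopic_with_trans homotopic_with_symD by blast
qed

lemma some_in_hinf_class:
  assumes "f \<in> hinf_maps X x0"
  shows "(SOME g. g \<in> hinf_class X x0 f) \<in> hinf_maps X x0"
    and "homotopic_with (\<lambda>h. h hjoin_base = x0) hawaiian_inf X f (SOME g. g \<in> hinf_class X x0 f)"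
proof -
  have "f \<in> hinf_class X x0 f"
    using assms by (simp add: hinf_class_def hinf_maps_def)
  then have "(SOME g. g \<in> hinf_class X x0 f) \<in> hinf_class X x0 f"
    by (rule someI[of "\<lambda>g. g \<in> hinf_class X x0 f"])
  then show "(SOME g. g \<in> hinf_class X x0 f) \<in> hinf_maps X x0"
    "homotopic_with (\<lambda>h. h hjoin_base = x0) hawaiian_inf X f (SOME g. g \<in> hinf_class X x0 f)"
    by (simp_all add: hinf_class_def)
qed

text \<open>On each sphere \<open>hinf_concat\<close> agrees with the cube concatenation on the cube
  itself, which is enough for equality of classes; the product of \<open>sum_group\<close> is taken
  entrywise.\<close>

lemma sphere_classes_concat:
  assumes x0: "x0 \<in> topspace X" and f: "f \<in> hinf_maps X x0" and g: "g \<in> hinf_maps X x0"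
  shows "sphere_classes X x0 (hinf_concat X x0 f g) =
    sphere_classes X x0 f \<otimes>\<^bsub>sum_group {1..} (\<lambda>n. sum_group {1..} (\<lambda>k::nat. homotopy_group n X x0))\<^esub> sphere_classes X x0 g"
  unfolding sphere_classes_def mult_sum_group
proof (intro restrict_ext)
  fix n k :: nat assume "n \<in> {1..}" "k \<in> {1..}"
  then have nk: "n \<ge> 1" "k \<ge> 1" by auto
  let ?f = "\<lambda>n k t. f (hjoin_sphere n k t)" and ?g = "\<lambda>n k t. g (hjoin_sphere n k t)"
  have "hclass n X x0 (\<lambda>t. hinf_concat X x0 f g (hjoin_sphere n k t)) = hclass n X x0 (cube_concat (?f n k) (?g n k))"
    by (intro hclass_eqI hrel_homotopic_equal hinf_maps_restrict[OF nk] hinf_concat[OF f g x0] nk)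
  also have "\<dots> = hclass n X x0 (?f n k) \<otimes>\<^bsub>homotopy_group n X x0\<^esub> hclass n X x0 (?g n k)"
    by (simp only: mult_hclass[OF nk(1) hinf_maps_restrict[OF nk f] hinf_maps_restrict[OF nk g]])
  finally show "hclass n X x0 (\<lambda>t. hinf_concat X x0 f g (hjoin_sphere n k t)) =
      (\<lambda>n\<in>{1..}. \<lambda>k\<in>{1..}. hclass n X x0 (?f n k)) n k \<otimes>\<^bsub>homotopy_group n X x0\<^esub>
      (\<lambda>n\<in>{1..}. \<lambda>k\<in>{1..}. hclass n X x0 (?g n k)) n k"
    using nk by simp
qed

section \<open>The iterated weak product and its elements\<close>

lemma carrier_homotopy_group: "carrier (homotopy_group n X x0) = hclass n X x0 ` hsph_maps n X x0"
  by (simp add: homotopy_group_def)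

lemma one_homotopy_group: "\<one>\<^bsub>homotopy_group n X x0\<^esub> = hclass n X x0 (\<lambda>_. x0)"
  by (simp add: homotopy_group_def)

lemma PiE_Collect_iff: "x \<in> (\<Pi>\<^sub>E i\<in>I. {y \<in> B i. P i y}) \<longleftrightarrow> x \<in> Pi\<^sub>E I B \<and> (\<forall>i\<in>I. P i (x i))"
  by (auto simp: PiE_iff)

text \<open>Finitely many nontrivial rows, each with finitely many nontrivial entries, amount to
  finitely many nontrivial pairs. \<open>carrier_sum_group\<close> is applied once inside and once
  outside, using that the factors are groups.\<close>

lemma carrier_weak_product:
  assumes "x0 \<in> topspace X"
  shows "carrier (sum_group {1..} (\<lambda>n. sum_group {1..} (\<lambda>k::nat. homotopy_group n X x0))) =
    {x \<in> \<Pi>\<^sub>E n\<in>{1..}. \<Pi>\<^sub>E k\<in>{1..}. hclass n X x0 ` hsph_maps n X x0.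
      finite {(n, k). n \<ge> 1 \<and> k \<ge> 1 \<and> x n k \<noteq> hclass n X x0 (\<lambda>_. x0)}}" (is "_ = ?R")
proof -
  have grp: "group (homotopy_group n X x0)" if "n \<in> {1..}" for n
    using that assms by (simp add: group_homotopy_group)
  have inner: "carrier (sum_group {1..} (\<lambda>k::nat. homotopy_group n X x0)) =
      {y \<in> \<Pi>\<^sub>E k\<in>{1..}. hclass n X x0 ` hsph_maps n X x0. finite {k \<in> {1..}. y k \<noteq> hclass n X x0 (\<lambda>_. x0)}}" if "n \<in> {1..}" for n
    unfolding carrier_sum_group[OF grp[OF that]] carrier_homotopy_group one_homotopy_group ..
  have one_iff: "y = \<one>\<^bsub>sum_group {1..} (\<lambda>k::nat. homotopy_group n X x0)\<^esub> \<longleftrightarrow> (\<forall>k\<ge>1. y k = hclass n X x0 (\<lambda>_. x0))"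
    if "y \<in> (\<Pi>\<^sub>E k\<in>{1..}. hclass n X x0 ` hsph_maps n X x0)" for y :: "nat \<Rightarrow> _" and n
  proof
    assume "\<forall>k\<ge>1. y k = hclass n X x0 (\<lambda>_. x0)"
    with that show "y = \<one>\<^bsub>sum_group {1..} (\<lambda>k::nat. homotopy_group n X x0)\<^esub>"
      by (intro extensionalityI[of _ "{1..}"]) (simp_all add: one_homotopy_group PiE_def)
  qed (simp add: one_homotopy_group)
  have "x \<in> carrier (sum_group {1..} (\<lambda>n. sum_group {1..} (\<lambda>k::nat. homotopy_group n X x0))) \<longleftrightarrow> x \<in> ?R" for x
  proof -
    let ?bad = "{(n, k). n \<ge> 1 \<and> k \<ge> 1 \<and> x n k \<noteq> hclass n X x0 (\<lambda>_. x0)}"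
    let ?in = "\<lambda>n. {k \<in> {1..}. x n k \<noteq> hclass n X x0 (\<lambda>_. x0)}"
    let ?out = "{n \<in> {1..}. x n \<noteq> \<one>\<^bsub>sum_group {1..} (\<lambda>k::nat. homotopy_group n X x0)\<^esub>}"
    have "x \<in> carrier (sum_group {1..} (\<lambda>n. sum_group {1..} (\<lambda>k::nat. homotopy_group n X x0))) \<longleftrightarrow>
       x \<in> (\<Pi>\<^sub>E n\<in>{1..}. carrier (sum_group {1..} (\<lambda>k::nat. homotopy_group n X x0))) \<and> finite ?out"
      by (subst carrier_sum_group) (use grp in auto)
    also have "\<dots> \<longleftrightarrow> x \<in> (\<Pi>\<^sub>E n\<in>{1..}. \<Pi>\<^sub>E k\<in>{1..}. hclass n X x0 ` hsph_maps n X x0) \<and> (\<forall>n\<ge>1. finite (?in n)) \<and> finite ?out"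
    proof -
      have eq: "(\<Pi>\<^sub>E n\<in>{1..}. carrier (sum_group {1..} (\<lambda>k::nat. homotopy_group n X x0))) =
          (\<Pi>\<^sub>E n\<in>{1..}. {y \<in> \<Pi>\<^sub>E k\<in>{1..}. hclass n X x0 ` hsph_maps n X x0. finite {k \<in> {1..}. y k \<noteq> hclass n X x0 (\<lambda>_. x0)}})"
        by (rule PiE_cong) (rule inner)
      show ?thesis
        unfolding eq PiE_Collect_iff by (simp only: conj_assoc Ball_def atLeast_iff)
    qed
    also have "\<dots> \<longleftrightarrow> x \<in> (\<Pi>\<^sub>E n\<in>{1..}. \<Pi>\<^sub>E k\<in>{1..}. hclass n X x0 ` hsph_maps n X x0) \<and> finite ?bad"
    proof (rule conj_cong[OF refl])
      assume x: "x \<in> (\<Pi>\<^sub>E n\<in>{1..}. \<Pi>\<^sub>E k\<in>{1..}. hclass n X x0 ` hsph_maps n X x0)"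
      have xn: "x n \<in> (\<Pi>\<^sub>E k\<in>{1..}. hclass n X x0 ` hsph_maps n X x0)" if "n \<in> {1..}" for n
        using PiE_mem[OF x that] .
      have trivial_iff: "x n = \<one>\<^bsub>sum_group {1..} (\<lambda>k::nat. homotopy_group n X x0)\<^esub> \<longleftrightarrow> (\<forall>k\<ge>1. x n k = hclass n X x0 (\<lambda>_. x0))"
        if "n \<in> {1..}" for n
        using one_iff[OF xn[OF that]] .
      show "(\<forall>n\<ge>1. finite (?in n)) \<and> finite ?out \<longleftrightarrow> finite ?bad"
      proof
        assume fin: "(\<forall>n\<ge>1. finite (?in n)) \<and> finite ?out"
        then have "finite (SIGMA n:?out. ?in n)"
          by (intro finite_SigmaI) simp_all
        moreover have "?bad \<subseteq> (SIGMA n:?out. ?in n)"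
        proof (rule subrelI)
          fix n k assume "(n, k) \<in> ?bad"
          then show "(n, k) \<in> (SIGMA n:?out. ?in n)"
            using trivial_iff[of n] by simp blast
        qed
        ultimately show "finite ?bad"
          by (rule rev_finite_subset)
      next
        assume fin: "finite ?bad"
        have "?in n \<subseteq> snd ` ?bad" if "n \<ge> 1" for n
        proof
          fix k assume "k \<in> ?in n"
          then show "k \<in> snd ` ?bad"
            using that by (intro image_eqI[of _ _ "(n, k)"]) simp_all
        qed
        moreover have "?out \<subseteq> fst ` ?bad"
        proof
          fix n assume n: "n \<in> ?out"
          then obtain k where "k \<ge> 1" "x n k \<noteq> hclass n X x0 (\<lambda>_. x0)"
            using trivial_iff[of n] by blast
          with n show "n \<in> fst ` ?bad"
            by (intro image_eqI[of _ _ "(n, k)"]) simp_all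
        qed
        ultimately show "(\<forall>n\<ge>1. finite (?in n)) \<and> finite ?out"
          using fin by (meson finite_imageI finite_subset)
      qed
    qed
    finally show ?thesis by simp
  qed
  then show ?thesis by blast
qed

lemma finite_nontrivial_sphere_classes:
  assumes x0: "x0 \<in> topspace X" and lic: "locally_infinite_connected X x0" and f: "f \<in> hinf_maps X x0"
  shows "finite {(n, k). n \<ge> 1 \<and> k \<ge> 1 \<and> sphere_classes X x0 f n k \<noteq> hclass n X x0 (\<lambda>_. x0)}" (is "finite ?bad")
proof -
  \<comment> \<open>Triviality in \<open>homotopy_group\<close> concerns homotopies in all of
    \<open>X\<close>, so local connectedness is applied with the whole space as target.\<close>
  obtain W where W: "openin X W" "x0 \<in> W"
    "\<And>n f. \<lbrakk>n \<ge> 1; f \<in> hsph_maps n X x0; f ` topspace (hcube_top n) \<subseteq> W\<rbrakk> \<Longrightarrow>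
      hrel_homotopic n (subtopology X (topspace X)) x0 f (\<lambda>_. x0)"
    using locally_infinite_connectedD[OF lic openin_topspace x0] by metis
  let ?B = "{(n, k). n \<ge> 1 \<and> k \<ge> 1 \<and> \<not> (\<lambda>t. f (hjoin_sphere n k t)) ` topspace (hcube_top n) \<subseteq> W}"
  have "finite ?B"
    using hinf_maps_null[OF f W(1,2)] .
  moreover have "?bad \<subseteq> ?B"
  proof (rule subrelI)
    fix n k assume "(n, k) \<in> ?bad"
    then have nk: "n \<ge> 1" "k \<ge> 1" and "sphere_classes X x0 f n k \<noteq> hclass n X x0 (\<lambda>_. x0)"
      by auto
    then have ne: "hclass n X x0 (\<lambda>t. f (hjoin_sphere n k t)) \<noteq> hclass n X x0 (\<lambda>_. x0)"
      by (simp add: sphere_classes_def)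
    have "\<not> (\<lambda>t. f (hjoin_sphere n k t)) ` topspace (hcube_top n) \<subseteq> W"
    proof
      assume "(\<lambda>t. f (hjoin_sphere n k t)) ` topspace (hcube_top n) \<subseteq> W"
      from W(3)[OF nk(1) hinf_maps_restrict[OF nk f] this]
      have "hrel_homotopic n X x0 (\<lambda>t. f (hjoin_sphere n k t)) (\<lambda>_. x0)"
        by simp
      from ne hclass_eqI[OF this] show False ..
    qed
    then show "(n, k) \<in> ?B"
      using nk by simp
  qed
  ultimately show ?thesis
    by (rule rev_finite_subset)
qed

lemma sphere_classes_surj:
  assumes x0: "x0 \<in> topspace X"
    and x: "x \<in> (\<Pi>\<^sub>E n\<in>{1..}. \<Pi>\<^sub>E k\<in>{1..}. hclass n X x0 ` hsph_maps n X x0)"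
    and fin: "finite {(n, k). n \<ge> 1 \<and> k \<ge> 1 \<and> x n k \<noteq> hclass n X x0 (\<lambda>_. x0)}"
  obtains f where "f \<in> hinf_maps X x0" "sphere_classes X x0 f = x"
proof -
  \<comment> \<open>Trivial entries get the constant map itself: an arbitrary nullhomotopic
    representative could leave a given neighbourhood on infinitely many spheres.\<close>
  define G where "G n k = (if x n k = hclass n X x0 (\<lambda>_. x0) then (\<lambda>_. x0)
      else SOME g. g \<in> hsph_maps n X x0 \<and> x n k = hclass n X x0 g)" for n k
  have G: "G n k \<in> hsph_maps n X x0 \<and> x n k = hclass n X x0 (G n k)" if nk: "n \<ge> 1" "k \<ge> 1" for n k
  proof (cases "x n k = hclass n X x0 (\<lambda>_. x0)")
    case True
    then show ?thesis
      by (simp add: G_def hsph_const[OF x0])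
  next
    case False
    have "x n k \<in> hclass n X x0 ` hsph_maps n X x0"
      using PiE_mem[OF PiE_mem[OF x, of n], of k] nk by simp
    then have "\<exists>g. g \<in> hsph_maps n X x0 \<and> x n k = hclass n X x0 g"
      by blast
    from someI_ex[OF this] show ?thesis
      using False by (simp add: G_def)
  qed
  have null: "finite {(n, k). n \<ge> 1 \<and> k \<ge> 1 \<and> \<not> G n k ` topspace (hcube_top n) \<subseteq> U}" if "openin X U" "x0 \<in> U" for U
    using fin
  proof (rule rev_finite_subset, intro subrelI)
    fix n k assume "(n, k) \<in> {(n, k). n \<ge> 1 \<and> k \<ge> 1 \<and> \<not> G n k ` topspace (hcube_top n) \<subseteq> U}"
    then have nk: "n \<ge> 1" "k \<ge> 1" and "\<not> G n k ` topspace (hcube_top n) \<subseteq> U"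
      by auto
    then show "(n, k) \<in> {(n, k). n \<ge> 1 \<and> k \<ge> 1 \<and> x n k \<noteq> hclass n X x0 (\<lambda>_. x0)}"
      using nk that(2) by (auto simp: G_def)
  qed
  obtain f where f: "f \<in> hinf_maps X x0"
    "\<And>n k t. \<lbrakk>n \<ge> 1; k \<ge> 1; t \<in> topspace (hcube_top n)\<rbrakk> \<Longrightarrow> f (hjoin_sphere n k t) = G n k t"
    using hinf_maps_glue[where F=G and X=X and ?x0.0=x0, OF conjunct1[OF G] null x0] by blast
  have "hclass n X x0 (\<lambda>t. f (hjoin_sphere n k t)) = x n k" if nk: "n \<ge> 1" "k \<ge> 1" for n k
  proof -
    have "hclass n X x0 (\<lambda>t. f (hjoin_sphere n k t)) = hclass n X x0 (G n k)"
      by (intro hclass_eqI hrel_homotopic_equal hinf_maps_restrict[OF nk f(1)] f(2) nk)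
    then show ?thesis
      using G[OF nk] by simp
  qed
  then have cl: "sphere_classes X x0 f n k = x n k" if "n \<in> {1..}" "k \<in> {1..}" for n k
    using that by (simp add: sphere_classes_def)
  have "sphere_classes X x0 f = x"
  proof (rule extensionalityI)
    fix n :: nat assume n: "n \<in> {1..}"
    show "sphere_classes X x0 f n = x n"
    proof (rule extensionalityI)
      show "sphere_classes X x0 f n \<in> extensional {1..}"
        using n by (simp add: sphere_classes_def)
      show "x n \<in> extensional {1..}"
        using PiE_mem[OF x n] by (simp add: PiE_def)
    qed (use cl n in auto)
  next
    show "x \<in> extensional {1..}"
      using x by (simp add: PiE_def)
  qed (simp add: sphere_classes_def)
  then show thesis
    using that f(1) by blast
qed

theorem theorem3p3:
  fixes X :: "'a topology" and x0 :: 'a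
  assumes "x0 \<in> topspace X"
    and "first_countable_at X x0"
    and "locally_infinite_connected X x0"
  shows "Hinf_group X x0 \<cong>
         sum_group {1..} (\<lambda>n::nat. sum_group {1..} (\<lambda>k::nat. homotopy_group n X x0))"
proof -
  let ?S = "sum_group {1..} (\<lambda>n::nat. sum_group {1..} (\<lambda>k::nat. homotopy_group n X x0))"
  let ?c = "hinf_class X x0" and ?K = "sphere_classes X x0"
  \<comment> \<open>The representative is chosen exactly as in the product of
    \<open>Hinf_group\<close>. Multiplicativity then concerns the same two maps on both sides, and
    no separate homotopy invariance of \<open>hinf_concat\<close> enters.\<close>
  define \<Phi> where "\<Phi> A = ?K (SOME f. f \<in> A)" for A
  have car: "carrier (Hinf_group X x0) = ?c ` hinf_maps X x0"
    by (simp add: Hinf_group_def)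
  have \<Phi>_class: "\<Phi> (?c f) = ?K f" if "f \<in> hinf_maps X x0" for f
    using sphere_classes_eq_iff[OF assms that some_in_hinf_class(1)[OF that]] some_in_hinf_class(2)[OF that]
    by (simp add: \<Phi>_def)
  have K_in: "?K f \<in> carrier ?S" if f: "f \<in> hinf_maps X x0" for f
    unfolding carrier_weak_product[OF assms(1)]
    using finite_nontrivial_sphere_classes[OF assms(1,3) f] hinf_maps_restrict[OF _ _ f]
    by (simp add: sphere_classes_def)
  have "\<Phi> \<in> hom (Hinf_group X x0) ?S"
  proof (rule homI)
    fix A assume "A \<in> carrier (Hinf_group X x0)"
    then show "\<Phi> A \<in> carrier ?S"
      unfolding car using \<Phi>_class K_in by auto
  next
    fix A B assume "A \<in> carrier (Hinf_group X x0)" "B \<in> carrier (Hinf_group X x0)"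
    then obtain f g where f: "f \<in> hinf_maps X x0" "A = ?c f" and g: "g \<in> hinf_maps X x0" "B = ?c g"
      unfolding car by auto
    let ?f = "SOME f. f \<in> A" and ?g = "SOME g. g \<in> B"
    have rep: "?f \<in> hinf_maps X x0" "?g \<in> hinf_maps X x0"
      using some_in_hinf_class(1)[OF f(1)] some_in_hinf_class(1)[OF g(1)] f(2) g(2) by simp_all
    have "\<Phi> (A \<otimes>\<^bsub>Hinf_group X x0\<^esub> B) = \<Phi> (?c (hinf_concat X x0 ?f ?g))"
      by (simp add: Hinf_group_def)
    also have "\<dots> = ?K (hinf_concat X x0 ?f ?g)"
      by (rule \<Phi>_class[OF hinf_concat(1)[OF rep assms(1)]])
    also have "\<dots> = \<Phi> A \<otimes>\<^bsub>?S\<^esub> \<Phi> B"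
      unfolding \<Phi>_def by (rule sphere_classes_concat[OF assms(1) rep])
    finally show "\<Phi> (A \<otimes>\<^bsub>Hinf_group X x0\<^esub> B) = \<Phi> A \<otimes>\<^bsub>?S\<^esub> \<Phi> B" .
  qed
  moreover have "bij_betw \<Phi> (carrier (Hinf_group X x0)) (carrier ?S)"
  proof (rule bij_betw_imageI)
    show "inj_on \<Phi> (carrier (Hinf_group X x0))"
    proof (rule inj_onI)
      fix A B assume "A \<in> carrier (Hinf_group X x0)" "B \<in> carrier (Hinf_group X x0)" and eq: "\<Phi> A = \<Phi> B"
      then obtain f g where f: "f \<in> hinf_maps X x0" "A = ?c f" and g: "g \<in> hinf_maps X x0" "B = ?c g"
        unfolding car by auto
      then show "A = B"
        using eq \<Phi>_class sphere_classes_eq_iff[OF assms f(1) g(1)] hinf_class_eq_iff[OF f(1) g(1)] by simp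
    qed
    show "\<Phi> ` carrier (Hinf_group X x0) = carrier ?S"
    proof
      show "\<Phi> ` carrier (Hinf_group X x0) \<subseteq> carrier ?S"
        unfolding car using \<Phi>_class K_in by auto
      show "carrier ?S \<subseteq> \<Phi> ` carrier (Hinf_group X x0)"
      proof
        fix x assume "x \<in> carrier ?S"
        then obtain f where "f \<in> hinf_maps X x0" "?K f = x"
          unfolding carrier_weak_product[OF assms(1)] using sphere_classes_surj[OF assms(1), of x] by blast
        then show "x \<in> \<Phi> ` carrier (Hinf_group X x0)"
          unfolding car using \<Phi>_class by (metis imageI)
      qed
    qed
  qed
  ultimately show ?thesis
    by (auto simp: is_iso_def iso_def)
qed

end
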